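(* There are exactly 6 affine equivalence classes of disconnected proper linear 3-periodic nets in $\mathbb{R}^3$ with adjacency depth 1 and a single vertex quotient graph.
   Context: A (proper) linear 3-periodic net (embedded net) in $\mathbb{R}^3$ is a pair $\mathcal{N}=(N,S)$ where (i) $S$, the set of edges, is a countable set of line segments $[p,q]$, $p\ne q$, which are essentially disjoint (two distinct segments meet at most in a common endpoint); (ii) $N$, the set of nodes, is the set of endpoints of members of $S$; (iii) there is a basis $\underline{a}=\{a_1,a_2,a_3\}$ of $\mathbb{R}^3$ such that $N$ and $S$ are invariant under the group $\mathcal{T}(\underline{a})$ of translations $T_k:x\mapsto x+k_1a_1+k_2a_2+k_3a_3$, $k\in\mathbb{Z}^3$; (iv) $N$ and $S$ partition into finitely many $\mathcal{T}(\underline{a})$-orbits. Such a basis is a periodicity basis; it is primitive if there is no periodicity basis $\underline{b}$ with $\mathcal{T}(\underline{a})$ a proper subset of $\mathcal{T}(\underline{b})$. The net is disconnected if its structure graph (vertices the nodes, edges the segments in $S$) has more than one (possibly infinitely many) connected components. The labelled quotient graph $\mathrm{LQG}(\mathcal{N};\underline{a})$: its vertices correspond to $\mathcal{T}(\underline{a})$-orbits of nodes, with chosen representatives $p(v)$; its edges correspond to orbits of edges, and an edge $[T_kp(v),T_lp(w)]$ gives an edge directed from $v$ to $w$ labelled $k-l\in\mathbb{Z}^3$ ($(vw,m)$ being identified with $(wv,-m)$). (When there is a single vertex the labels, up to sign, do not depend on the representative.) The quotient graph of $\mathcal{N}$ is the unlabelled multigraph underlying $\mathrm{LQG}(\mathcal{N};\underline{a})$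 for a primitive periodicity basis $\underline{a}$. The depth of a labelled quotient graph is the maximum modulus of the coordinates of its edge labels; the adjacency depth $\nu(\mathcal{N})$ is the minimum of the depths of $\mathrm{LQG}(\mathcal{N};\underline{a})$ over all primitive periodicity bases $\underline{a}$. Nets $\mathcal{N}_1,\mathcal{N}_2$ are affinely equivalent if there are translates of $\mathcal{N}_1$ and $\mathcal{N}_2$ such that one is carried to the other by a matrix $X\in GL(3,\mathbb{R})$. *)

theory Defs
  imports "HOL-Analysis.Analysis"
begin

section \<open>Linear 3-periodic nets\<close>

text \<open>A net is a pair of a set of nodes and a set of edges; an edge is a line segment, regarded as
  a set of points.\<close>

type_synonym pt = "real ^ 3"
type_synonym net = "pt set \<times> pt set set"
type_synonym label = "int ^ 3"

definition is_segment :: "pt set \<Rightarrow> bool" where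
  "is_segment s \<longleftrightarrow> (\<exists>p q. p \<noteq> q \<and> s = closed_segment p q)"

definition endpoint :: "pt \<Rightarrow> pt set \<Rightarrow> bool" where
  "endpoint p s \<longleftrightarrow> (\<exists>q. p \<noteq> q \<and> s = closed_segment p q)"

definition essentially_disjoint :: "pt set set \<Rightarrow> bool" where
  "essentially_disjoint S \<longleftrightarrow>
     (\<forall>s\<in>S. \<forall>t\<in>S. s \<noteq> t \<longrightarrow>
        s \<inter> t = {} \<or> (\<exists>x. s \<inter> t = {x} \<and> endpoint x s \<and> endpoint x t))"

definition is_basis :: "(3 \<Rightarrow> pt) \<Rightarrow> bool" where
  "is_basis a \<longleftrightarrow> inj a \<and> independent (range a) \<and> span (range a) = UNIV"

definition translation :: "(3 \<Rightarrow> pt) \<Rightarrow> int ^ 3 \<Rightarrow> pt \<Rightarrow> pt" where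
  "translation a k x = x + (\<Sum>i\<in>UNIV. of_int (k $ i) *\<^sub>R a i)"

definition translation_group :: "(3 \<Rightarrow> pt) \<Rightarrow> (pt \<Rightarrow> pt) set" where
  "translation_group a = range (translation a)"

definition node_orbits :: "(3 \<Rightarrow> pt) \<Rightarrow> net \<Rightarrow> pt set set" where
  "node_orbits a \<N> = (\<lambda>p. {g p | g. g \<in> translation_group a}) ` fst \<N>"

definition edge_orbits :: "(3 \<Rightarrow> pt) \<Rightarrow> net \<Rightarrow> pt set set set" where
  "edge_orbits a \<N> = (\<lambda>s. {g ` s | g. g \<in> translation_group a}) ` snd \<N>"

definition periodicity_basis :: "net \<Rightarrow> (3 \<Rightarrow> pt) \<Rightarrow> bool" where
  "periodicity_basis \<N> a \<longleftrightarrow>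
     is_basis a \<and>
     (\<forall>g\<in>translation_group a. g ` fst \<N> = fst \<N> \<and> (`) g ` snd \<N> = snd \<N>) \<and>
     finite (node_orbits a \<N>) \<and> finite (edge_orbits a \<N>)"

definition proper_linear_3_periodic_net :: "net \<Rightarrow> bool" where
  "proper_linear_3_periodic_net \<N> \<longleftrightarrow>
     countable (snd \<N>) \<and> (\<forall>s\<in>snd \<N>. is_segment s) \<and> essentially_disjoint (snd \<N>) \<and>
     fst \<N> = {p. \<exists>s\<in>snd \<N>. endpoint p s} \<and>
     (\<exists>a. periodicity_basis \<N> a)"

definition primitive_basis :: "net \<Rightarrow> (3 \<Rightarrow> pt) \<Rightarrow> bool" where
  "primitive_basis \<N> a \<longleftrightarrow>
     periodicity_basis \<N> a \<and>
     \<not> (\<exists>b. periodicity_basis \<N> b \<and> translation_group a \<subset> translation_group b)"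

section \<open>The structure graph\<close>

definition adjacency :: "net \<Rightarrow> (pt \<times> pt) set" where
  "adjacency \<N> = {(p, q). p \<in> fst \<N> \<and> q \<in> fst \<N> \<and> closed_segment p q \<in> snd \<N>}"

definition net_components :: "net \<Rightarrow> pt set set" where
  "net_components \<N> = fst \<N> // (adjacency \<N>)\<^sup>*"

definition disconnected_net :: "net \<Rightarrow> bool" where
  "disconnected_net \<N> \<longleftrightarrow> (\<exists>C\<in>net_components \<N>. \<exists>D\<in>net_components \<N>. C \<noteq> D)"

section \<open>Labelled quotient graphs\<close>

text \<open>The identification of the labelled directed edges \<open>(v, w, m)\<close> and \<open>(w, v, -m)\<close> is realised by
  taking the set of both triples as the edge. Distinct edges between the same vertices carry
  distinct labels up to this identification, so no multiplicities are lost.\<close>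

record 'v labelled_graph =
  lg_verts :: "'v set"
  lg_edges :: "('v \<times> 'v \<times> label) set set"

record ('v, 'e) multigraph =
  mg_verts :: "'v set"
  mg_edges :: "'e set"
  mg_ends :: "'e \<Rightarrow> 'v set"

definition representatives :: "net \<Rightarrow> (3 \<Rightarrow> pt) \<Rightarrow> (pt set \<Rightarrow> pt) \<Rightarrow> bool" where
  "representatives \<N> a p \<longleftrightarrow> (\<forall>v\<in>node_orbits a \<N>. p v \<in> v)"

definition LQG :: "net \<Rightarrow> (3 \<Rightarrow> pt) \<Rightarrow> (pt set \<Rightarrow> pt) \<Rightarrow> pt set labelled_graph" where
  "LQG \<N> a p =
     \<lparr> lg_verts = node_orbits a \<N>,
       lg_edges = {{(v, w, k - l), (w, v, - (k - l))} | v w k l.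
          v \<in> node_orbits a \<N> \<and> w \<in> node_orbits a \<N> \<and>
          closed_segment (translation a k (p v)) (translation a l (p w)) \<in> snd \<N>} \<rparr>"

definition underlying_multigraph ::
    "'v labelled_graph \<Rightarrow> ('v, ('v \<times> 'v \<times> label) set) multigraph" where
  "underlying_multigraph L =
     \<lparr> mg_verts = lg_verts L,
       mg_edges = lg_edges L,
       mg_ends = (\<lambda>e. {v. \<exists>w m. (v, w, m) \<in> e}) \<rparr>"

text \<open>The quotient graph of a net is determined only up to isomorphism, hence a predicate.\<close>

definition is_quotient_graph ::
    "net \<Rightarrow> (pt set, (pt set \<times> pt set \<times> label) set) multigraph \<Rightarrow> bool" where
  "is_quotient_graph \<N> G \<longleftrightarrow>
     (\<exists>a p. primitive_basis \<N> a \<and> representatives \<N> a p \<and> G = underlying_multigraph (LQG \<N> a p))"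

definition single_vertex_quotient_graph :: "net \<Rightarrow> bool" where
  "single_vertex_quotient_graph \<N> \<longleftrightarrow> (\<exists>G. is_quotient_graph \<N> G \<and> card (mg_verts G) = 1)"

definition depth :: "'v labelled_graph \<Rightarrow> nat" where
  "depth L = Max {nat \<bar>m $ i\<bar> | v w m i. \<exists>e\<in>lg_edges L. (v, w, m) \<in> e}"

text \<open>In general the labels depend on the chosen representatives as well as on the basis; the
  minimum is taken over both. With a single vertex the choice of representative is immaterial.\<close>

definition adjacency_depth :: "net \<Rightarrow> nat" where
  "adjacency_depth \<N> =
     (LEAST d. \<exists>a p. primitive_basis \<N> a \<and> representatives \<N> a p \<and> d = depth (LQG \<N> a p))"

section \<open>Affine equivalence\<close>

definition map_net :: "(pt \<Rightarrow> pt) \<Rightarrow> net \<Rightarrow> net" where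
  "map_net f \<N> = (f ` fst \<N>, (`) f ` snd \<N>)"

definition affine_equivalence :: "(net \<times> net) set" where
  "affine_equivalence =
     {(\<M>, \<N>). proper_linear_3_periodic_net \<M> \<and> proper_linear_3_periodic_net \<N> \<and>
        (\<exists>u v (X :: real ^ 3 ^ 3). invertible X \<and>
           map_net ((*v) X) (map_net ((+) u) \<M>) = map_net ((+) v) \<N>)}"

end

theory Submission
  imports Defs
begin

text \<open>A net whose quotient graph has a single vertex is determined, up to an affine map, by the set of
  its edge labels: its nodes form a lattice, identified with the integer vectors, and its edges are the
  segments from \<open>k\<close> to \<open>k + f\<close>, where \<open>f\<close> runs through the labels
  (\<open>eq_lattice_net\<close>). Nets whose label sets correspond under an integral change of basis are
  affinely equivalent (\<open>lattice_net_basis_change\<close>, \<open>lattice_nets_affinely_equivalent\<close>),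
  and conversely an affine equivalence induces an automorphism of the integer lattice that matches the labels
  (\<open>affine_equivalence_labels\<close>). So label sets are counted up to automorphisms.

  Depth one means that the labels have entries in \<open>{-1, 0, 1}\<close>. For such labels the edges are
  essentially disjoint exactly if no two labels agree modulo 2, except for equal and opposite ones: edges
  with labels that agree modulo 2 have translates with the same midpoint (\<open>uncrossed_labels\<close>), while
  labels that are distinct modulo 2 have a minor \<open>\<plusminus> 1\<close>, so that their edges meet only in
  lattice points (\<open>essentially_disjoint_lattice_net\<close>). If the net is disconnected, no three labels
  have determinant \<open>\<plusminus> 1\<close> (\<open>unimodular_labels_connected\<close>), and this leaves few
  possibilities (\<open>label_set_classification\<close>).

  \<^item> If all determinants vanish, the labels lie on a line or in a plane, where two labels and possibly one
    of their diagonals are the only choices.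
  \<^item> If a nonzero determinant is even, it is \<open>\<plusminus> 2\<close>, the three labels are equivalent to
    \<open>(1,1,0), (1,0,1), (0,1,1)\<close>, and a further label would be divisible by 3.
  \<^item> Otherwise the nonzero determinants are \<open>\<plusminus> 3\<close>. Since labels are determined by
    their residues modulo 3, three independent labels have, with suitable signs, a sum divisible by 3, and at
    most one further label is possible, a difference of two of the three.

  These are six label sets. Each of them lies in the kernel of a linear functional, possibly taken modulo 2
  or 3, so the corresponding nets are disconnected. They are separated by the number of labels and by two
  further invariants of the label set under lattice automorphisms
  (\<open>normal_forms_inequivalent\<close>).\<close>

section \<open>Integer vectors and determinants\<close>

lemma exists_3: "(\<exists>i::3. P i) \<longleftrightarrow> P 1 \<or> P 2 \<or> P 3"
  by (metis exhaust_3)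

lemma vec_eq_3: "(x::'a^3) = y \<longleftrightarrow> x$1 = y$1 \<and> x$2 = y$2 \<and> x$3 = y$3"
  by (simp add: vec_eq_iff forall_3)

definition det3 :: "label \<Rightarrow> label \<Rightarrow> label \<Rightarrow> int" where
  "det3 f g h = det (vector [f, g, h])"

lemma det3_expand:
  "det3 f g h = f$1 * (g$2 * h$3 - g$3 * h$2) - f$2 * (g$1 * h$3 - g$3 * h$1)
     + f$3 * (g$1 * h$2 - g$2 * h$1)"
  by (simp add: det3_def det_3 algebra_simps)

lemma vector_matrix_3: "(c v* B) = c$1 *s B$1 + c$2 *s B$2 + c$3 *s B$3" for c :: label and B :: "int^3^3"
  by (simp add: vec_eq_3 vector_matrix_mult_def sum_3)

lemma det_rows: "det (B :: int^3^3) = det3 (B$1) (B$2) (B$3)"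
  by (simp add: det3_expand det_3) (simp add: algebra_simps)

text \<open>Cramer's rule with the denominator cleared: the coordinates of \<open>k\<close> in the basis
  \<open>f, g, u\<close> are determinants, which is how divisibility of determinants is turned into congruences
  between labels below.\<close>

lemma cramer:
  "det3 f g u *s k = det3 k g u *s f + det3 f k u *s g + det3 f g k *s u"
  by (simp add: vec_eq_3 det3_expand) (simp add: algebra_simps)

text \<open>Cramer's rule divides only by the determinant, so over the integers the rows of a matrix of
  determinant \<open>\<plusminus> 1\<close> generate the whole lattice.\<close>

lemma unimodular_surj:
  assumes "\<bar>det (B :: int^3^3)\<bar> = 1"
  obtains c where "k = c v* B"
proof -
  define d where "d = det B"
  define c where "c = (vector [det3 k (B$2) (B$3), det3 (B$1) k (B$3), det3 (B$1) (B$2) k] :: label)"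
  have "d * d = 1" using assms by (metis abs_mult_self_eq mult_1 d_def)
  moreover have "d *s k = c v* B"
    using cramer [of "B$1" "B$2" "B$3" k] by (simp add: vector_matrix_3 det_rows c_def d_def)
  then have "d *s (d *s k) = d *s (c v* B)" by simp
  ultimately have "k = (d *s c) v* B"
    by (simp add: vector_matrix_3 vec_eq_3 algebra_simps)
  then show thesis by (rule that)
qed

definition sym_closure :: "label set \<Rightarrow> label set" where
  "sym_closure F = F \<union> uminus ` F"

text \<open>These are the label sets for which the edges of a net of depth one are essentially disjoint: two
  labels that agree modulo 2 and are not opposite give two edges with a common midpoint, and there are no
  other crossings.\<close>

definition admissible :: "label set \<Rightarrow> bool" where
  "admissible F \<longleftrightarrow> F \<noteq> {} \<and> 0 \<notin> F \<and> (\<forall>f\<in>F. \<forall>i. \<bar>f$i\<bar> \<le> 1) \<and>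
     (\<forall>f\<in>F. \<forall>g\<in>F. (\<forall>i. even (f$i - g$i)) \<longrightarrow> g = f \<or> g = - f)"

text \<open>The six normal forms. The components of the nets that they describe are straight lines, planar
  square and triangular nets, primitive cubic nets (2 or 3 interpenetrating copies), and stacked triangular
  nets (3 interpenetrating copies). The coordinates of the last three are chosen inside the cube; the
  lattices that they generate are given by an even coordinate sum and by a coordinate sum divisible by 3.\<close>

definition "chain_labels = {vector [1,0,0] :: label}"
definition "square_labels = {vector [1,0,0], vector [0,1,0] :: label}"
definition "triangle_labels = {vector [1,0,0], vector [0,1,0], vector [1,1,0] :: label}"
definition "double_cubic_labels = {vector [1,1,0], vector [1,0,1], vector [0,1,1] :: label}"
definition "triple_cubic_labels = {vector [-1,1,0], vector [0,1,-1], vector [1,1,1] :: label}"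
definition "triple_prism_labels = {vector [-1,1,0], vector [0,1,-1], vector [1,1,1], vector [-1,0,1] :: label}"

definition unimodular_image :: "label set \<Rightarrow> label set \<Rightarrow> bool" where
  "unimodular_image C F \<longleftrightarrow> (\<exists>B :: int^3^3. \<bar>det B\<bar> = 1 \<and> F = sym_closure ((\<lambda>c. c v* B) ` C))"

lemma unimodular_imageI:
  assumes "\<bar>det3 x y z\<bar> = 1" "F = sym_closure ((\<lambda>c. c$1 *s x + c$2 *s y + c$3 *s z) ` C)"
  shows "unimodular_image C F"
  unfolding unimodular_image_def
  by (rule exI [of _ "vector [x, y, z]"]) (use assms in \<open>simp add: vector_matrix_3 det_rows\<close>)

section \<open>Vectors with entries in the unit cube\<close>

lemma abs_det2_le:
  assumes "\<bar>a\<bar> \<le> 1" "\<bar>b\<bar> \<le> 1" "\<bar>c\<bar> \<le> 1" "\<bar>d\<bar> \<le> (1::int)"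
  shows "\<bar>a*d - b*c\<bar> \<le> 2"
proof -
  have "\<bar>a*d\<bar> \<le> 1 * 1" "\<bar>b*c\<bar> \<le> 1*1" unfolding abs_mult by (intro mult_mono assms; simp)+
  then show ?thesis by linarith
qed

text \<open>Labels that are distinct and nonzero modulo 2 are linearly independent over the field of two
  elements, so some minor is odd; a minor of entries in \<open>{-1, 0, 1}\<close> is at most 2 in modulus, so
  an odd one is \<open>\<plusminus> 1\<close>. Geometrically, two such labels span a primitive plane lattice.\<close>

lemma unit_minor:
  fixes f g :: label
  assumes cube: "\<forall>i. \<bar>f$i\<bar> \<le> 1" "\<forall>i. \<bar>g$i\<bar> \<le> 1"
    and odd: "\<exists>i. odd (f$i)" "\<exists>i. odd (g$i)" "\<exists>i. odd (f$i - g$i)"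
  shows "\<bar>f$1*g$2 - f$2*g$1\<bar> = 1 \<or> \<bar>f$1*g$3 - f$3*g$1\<bar> = 1 \<or> \<bar>f$2*g$3 - f$3*g$2\<bar> = 1"
proof -
  have "\<bar>f$1*g$2 - f$2*g$1\<bar> \<le> 2" "\<bar>f$1*g$3 - f$3*g$1\<bar> \<le> 2" "\<bar>f$2*g$3 - f$3*g$2\<bar> \<le> 2"
    using cube by (auto intro: abs_det2_le)
  moreover have "odd (f$1*g$2 - f$2*g$1) \<or> odd (f$1*g$3 - f$3*g$1) \<or> odd (f$2*g$3 - f$3*g$2)"
    using odd unfolding exists_3 even_diff_iff even_add even_mult_iff by argo
  moreover have "odd x \<Longrightarrow> \<bar>x\<bar> \<le> 2 \<Longrightarrow> \<bar>x\<bar> = 1" for x :: int by presburger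
  ultimately show ?thesis by blast
qed

text \<open>The third basis vector is a coordinate vector up to sign, chosen against the unit minor. For this
  choice the two other coordinates of a label in the cube are again minors, hence at most 2 in modulus.\<close>

lemma completion:
  fixes f g :: label
  assumes cube: "\<forall>i. \<bar>f$i\<bar> \<le> 1" "\<forall>i. \<bar>g$i\<bar> \<le> 1"
    and odd: "\<exists>i. odd (f$i)" "\<exists>i. odd (g$i)" "\<exists>i. odd (f$i - g$i)"
  shows "\<exists>u. det3 f g u = 1 \<and> (\<forall>h. (\<forall>i. \<bar>h$i\<bar> \<le> 1) \<longrightarrow> \<bar>det3 f h u\<bar> \<le> 2 \<and> \<bar>det3 h g u\<bar> \<le> 2)"
proof -
  have "\<bar>f$1*g$2 - f$2*g$1\<bar> = 1 \<or> \<bar>f$1*g$3 - f$3*g$1\<bar> = 1 \<or> \<bar>f$2*g$3 - f$3*g$2\<bar> = 1"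
    by (rule unit_minor [OF assms])
  then obtain s :: int and u where "\<bar>s\<bar> = 1" and d1: "det3 f g u = 1"
    and u: "u = vector [0,0,s] \<or> u = vector [0,s,0] \<or> u = vector [s,0,0]"
  proof (elim disjE)
    assume a: "\<bar>f$1*g$2 - f$2*g$1\<bar> = 1"
    have "det3 f g (vector [0,0,f$1*g$2 - f$2*g$1]) = (f$1*g$2 - f$2*g$1)^2"
      by (simp add: det3_expand power2_eq_square algebra_simps)
    then show ?thesis using a that [of "f$1*g$2 - f$2*g$1"] by (simp add: abs_square_eq_1[symmetric])
  next
    assume a: "\<bar>f$1*g$3 - f$3*g$1\<bar> = 1"
    have "det3 f g (vector [0,-(f$1*g$3 - f$3*g$1),0]) = (f$1*g$3 - f$3*g$1)^2"
      by (simp add: det3_expand power2_eq_square algebra_simps)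
    then show ?thesis using a that [of "-(f$1*g$3 - f$3*g$1)"]
      by (simp add: abs_square_eq_1[symmetric] power2_commute)
  next
    assume a: "\<bar>f$2*g$3 - f$3*g$2\<bar> = 1"
    have "det3 f g (vector [f$2*g$3 - f$3*g$2,0,0]) = (f$2*g$3 - f$3*g$2)^2"
      by (simp add: det3_expand power2_eq_square algebra_simps)
    then show ?thesis using a that [of "f$2*g$3 - f$3*g$2"] by (simp add: abs_square_eq_1[symmetric])
  qed
  have d2: "\<bar>det3 x y u\<bar> \<le> 2" if "\<forall>i. \<bar>x$i\<bar> \<le> 1" "\<forall>i. \<bar>y$i\<bar> \<le> 1" for x y :: label
  proof -
    have "\<bar>x$1*y$2 - x$2*y$1\<bar> \<le> 2" "\<bar>x$1*y$3 - x$3*y$1\<bar> \<le> 2" "\<bar>x$2*y$3 - x$3*y$2\<bar> \<le> 2"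
      using that by (auto intro: abs_det2_le)
    moreover have "s = 1 \<or> s = -1" using \<open>\<bar>s\<bar> = 1\<close> by auto
    ultimately show ?thesis using u by (auto simp: det3_expand)
  qed
  show ?thesis using d1 d2 cube by blast
qed

lemma abs_eq_2_minor:
  assumes "\<bar>a\<bar> \<le> 1" "\<bar>b\<bar> \<le> 1" "\<bar>c\<bar> \<le> 1" "\<bar>d\<bar> \<le> (1::int)" "\<bar>a*d - b*c\<bar> = 2"
  shows "odd a \<and> odd b \<and> odd c \<and> odd d"
proof -
  have "\<bar>a*d\<bar> \<le> 1 * 1" "\<bar>b*c\<bar> \<le> 1*1" unfolding abs_mult by (intro mult_mono assms; simp)+
  with assms(5) have "\<bar>a*d\<bar> = 1" "\<bar>b*c\<bar> = 1" by linarith+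
  moreover have "\<bar>x\<bar> = 1 \<Longrightarrow> odd x" for x :: int by presburger
  ultimately have "odd (a*d)" "odd (b*c)" by blast+
  then show ?thesis by simp
qed

text \<open>Expand along \<open>f\<close>. A minor of modulus 2 forces its four entries to be odd, so if two of the
  minors \<open>A\<close>, \<open>B\<close>, \<open>C\<close> have modulus 2, then all entries of \<open>g\<close> and
  \<open>h\<close> are odd and the third minor is even. It is then 0, since three minors of modulus 2 are
  incompatible with the vanishing of the determinant with rows \<open>g, g, h\<close>. If moreover
  \<open>f + g + h\<close> is even and some minor has modulus 2, the two entries of \<open>f\<close> that
  multiply the other minors are 0.\<close>

lemma det3_bounds:
  assumes "\<forall>i. \<bar>f$i\<bar> \<le> 1" "\<forall>i. \<bar>g$i\<bar> \<le> 1" "\<forall>i. \<bar>h$i\<bar> \<le> 1"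
  shows det3_le_4: "\<bar>det3 f g h\<bar> \<le> 4"
    and det3_le_3: "\<forall>i. even (f$i + g$i + h$i) \<Longrightarrow> \<bar>det3 f g h\<bar> \<le> 3"
proof -
  define A where "A = g$2 * h$3 - g$3 * h$2"
  define B where "B = g$1 * h$3 - g$3 * h$1"
  define C where "C = g$1 * h$2 - g$2 * h$1"
  have d: "det3 f g h = f$1 * A - f$2 * B + f$3 * C"
    by (simp add: det3_expand A_def B_def C_def)
  have le2: "\<bar>A\<bar> \<le> 2" "\<bar>B\<bar> \<le> 2" "\<bar>C\<bar> \<le> 2"
    unfolding A_def B_def C_def using assms by (auto intro!: abs_det2_le)
  have t: "\<bar>f$i * x\<bar> \<le> \<bar>x\<bar>" for i x
    using assms(1) mult_right_mono [of "\<bar>f$i\<bar>" 1 "\<bar>x\<bar>"] by (simp add: abs_mult)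
  have D: "\<bar>det3 f g h\<bar> \<le> \<bar>A\<bar> + \<bar>B\<bar> + \<bar>C\<bar>"
    unfolding d using t [of 1 A] t [of 2 B] t [of 3 C] by linarith
  have oA: "\<bar>A\<bar> = 2 \<Longrightarrow> odd (g$2) \<and> odd (g$3) \<and> odd (h$2) \<and> odd (h$3)"
    using abs_eq_2_minor [of "g$2" "g$3" "h$2" "h$3"] assms unfolding A_def by blast
  have oB: "\<bar>B\<bar> = 2 \<Longrightarrow> odd (g$1) \<and> odd (g$3) \<and> odd (h$1) \<and> odd (h$3)"
    using abs_eq_2_minor [of "g$1" "g$3" "h$1" "h$3"] assms unfolding B_def by blast
  have oC: "\<bar>C\<bar> = 2 \<Longrightarrow> odd (g$1) \<and> odd (g$2) \<and> odd (h$1) \<and> odd (h$2)"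
    using abs_eq_2_minor [of "g$1" "g$2" "h$1" "h$2"] assms unfolding C_def by blast
  have two: "\<bar>A\<bar> \<noteq> 2 \<or> \<bar>B\<bar> \<noteq> 2 \<or> even C" "\<bar>A\<bar> \<noteq> 2 \<or> \<bar>C\<bar> \<noteq> 2 \<or> even B" "\<bar>B\<bar> \<noteq> 2 \<or> \<bar>C\<bar> \<noteq> 2 \<or> even A"
    using oA oB oC unfolding A_def B_def C_def by auto
  have all: "odd (g$i) \<and> odd (h$i)" if "\<bar>A\<bar> = 2 \<and> \<bar>B\<bar> = 2 \<or> \<bar>A\<bar> = 2 \<and> \<bar>C\<bar> = 2 \<or> \<bar>B\<bar> = 2 \<and> \<bar>C\<bar> = 2" for i
    using oA oB oC that exhaust_3 [of i] by auto
  have "\<not> (\<bar>A\<bar> = 2 \<and> \<bar>B\<bar> = 2 \<and> \<bar>C\<bar> = 2)"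
  proof
    assume a: "\<bar>A\<bar> = 2 \<and> \<bar>B\<bar> = 2 \<and> \<bar>C\<bar> = 2"
    have "\<bar>g$i\<bar> = 1" for i
    proof -
      have "odd (g$i)" "\<bar>g$i\<bar> \<le> 1" using a all assms(2) by blast+
      then show ?thesis by presburger
    qed
    then have "\<bar>g$1 * A\<bar> = 2" "\<bar>g$2 * B\<bar> = 2" "\<bar>g$3 * C\<bar> = 2"
      using a by (simp_all add: abs_mult)
    moreover have "g$1 * A - g$2 * B + g$3 * C = 0"
      by (simp add: A_def B_def C_def algebra_simps)
    ultimately show False by linarith
  qed
  moreover have ev: "even x \<Longrightarrow> \<bar>x\<bar> \<le> 2 \<Longrightarrow> \<bar>x\<bar> \<noteq> 2 \<Longrightarrow> \<bar>x\<bar> = 0" for x :: int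
    by presburger
  ultimately have zero: "\<bar>A\<bar> = 2 \<Longrightarrow> \<bar>B\<bar> = 2 \<Longrightarrow> \<bar>C\<bar> = 0" "\<bar>A\<bar> = 2 \<Longrightarrow> \<bar>C\<bar> = 2 \<Longrightarrow> \<bar>B\<bar> = 0"
    "\<bar>B\<bar> = 2 \<Longrightarrow> \<bar>C\<bar> = 2 \<Longrightarrow> \<bar>A\<bar> = 0"
    using two le2 by blast+
  have sum: "x + y + z \<le> 4" if "x \<le> 2" "y \<le> 2" "z \<le> 2" "x \<noteq> 2 \<or> y \<noteq> 2 \<or> z = 0" "x \<noteq> 2 \<or> z \<noteq> 2 \<or> y = 0"
    "y \<noteq> 2 \<or> z \<noteq> 2 \<or> x = 0" for x y z :: int
    using that by auto
  have "\<bar>A\<bar> + \<bar>B\<bar> + \<bar>C\<bar> \<le> 4"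
    by (rule sum [OF le2]) (use zero in blast)+
  with D show "\<bar>det3 f g h\<bar> \<le> 4" by linarith
  assume ev: "\<forall>i. even (f$i + g$i + h$i)"
  have z: "f$i = 0" if "odd (g$i)" "odd (h$i)" for i
  proof -
    have "even (f$i)" using ev that by (metis even_add)
    moreover have "\<bar>f$i\<bar> \<le> 1" using assms(1) by blast
    ultimately show ?thesis by presburger
  qed
  show "\<bar>det3 f g h\<bar> \<le> 3"
  proof -
    have "x \<le> 1 \<and> y \<le> 1 \<and> z \<le> 1 \<or> x = 2 \<or> y = 2 \<or> z = 2"
      if "x \<le> 2" "y \<le> 2" "z \<le> 2" for x y z :: int using that by auto
    from this [OF le2] consider "\<bar>A\<bar> \<le> 1" "\<bar>B\<bar> \<le> 1" "\<bar>C\<bar> \<le> 1" | "\<bar>A\<bar> = 2" | "\<bar>B\<bar> = 2" | "\<bar>C\<bar> = 2"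
      by blast
    then show ?thesis
    proof cases
      case 1 then show ?thesis using D by linarith
    next
      case 2
      then have "f$2 = 0" "f$3 = 0" using oA z by blast+
      then show ?thesis using d t [of 1 A] le2 by simp
    next
      case 3
      then have "f$1 = 0" "f$3 = 0" using oB z by blast+
      then show ?thesis using d t [of 2 B] le2 by simp
    next
      case 4
      then have "f$1 = 0" "f$2 = 0" using oC z by blast+
      then show ?thesis using d t [of 3 C] le2 by simp
    qed
  qed
qed

lemma cube_mod_3_inject:
  fixes f g :: label
  assumes "\<forall>i. \<bar>f$i\<bar> \<le> 1" "\<forall>i. \<bar>g$i\<bar> \<le> 1" "\<forall>i. 3 dvd f$i - g$i"
  shows "f = g"
proof -
  have "f$i = g$i" for i
  proof -
    have "\<bar>f$i\<bar> \<le> 1" "\<bar>g$i\<bar> \<le> 1" "3 dvd f$i - g$i" using assms by auto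
    then show ?thesis by presburger
  qed
  then show ?thesis by (simp add: vec_eq_iff)
qed

section \<open>Label sets without a unimodular triple\<close>

text \<open>Fixed here is a symmetric admissible label set no three members of which form a basis of the integer
  lattice. The last condition holds for the labels of disconnected nets.\<close>

context
  fixes F :: "label set"
  assumes adm: "admissible F" and minus: "\<And>f. f \<in> F \<Longrightarrow> - f \<in> F"
    and no_unimodular: "\<And>f g h. f \<in> F \<Longrightarrow> g \<in> F \<Longrightarrow> h \<in> F \<Longrightarrow> \<bar>det3 f g h\<bar> \<noteq> 1"
begin

lemma entry_le_1: "f \<in> F \<Longrightarrow> \<forall>i. \<bar>f$i\<bar> \<le> 1"
  using adm by (simp add: admissible_def)

lemma odd_entry: assumes "f \<in> F" shows "\<exists>i. odd (f$i)"
proof -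
  have "f \<noteq> 0" using adm assms by (auto simp: admissible_def)
  then obtain i where "f$i \<noteq> 0" by (auto simp: vec_eq_iff)
  moreover have "\<bar>f$i\<bar> \<le> 1" using entry_le_1 assms by blast
  ultimately have "odd (f$i)" by presburger
  then show ?thesis by blast
qed

lemma nonzero_mod_3: assumes "f \<in> F" "\<forall>i. 3 dvd f$i" shows False
  using cube_mod_3_inject [of f 0] entry_le_1 [OF assms(1)] assms odd_entry by fastforce

lemma odd_difference: "f \<in> F \<Longrightarrow> g \<in> F \<Longrightarrow> g \<notin> {f, - f} \<Longrightarrow> \<exists>i. odd (f$i - g$i)"
  using adm unfolding admissible_def by blast

text \<open>Modulo 2 a label that is dependent on \<open>f\<close> and \<open>g\<close> and differs from \<open>0\<close>,
  \<open>f\<close>, \<open>g\<close> must be \<open>f + g\<close>, so both coefficients are odd. They are at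
  most 2 in modulus by the choice of the third basis vector.\<close>

lemma even_combination:
  assumes F: "f \<in> F" "g \<in> F" "k \<in> F" and gf: "g \<notin> {f, - f}" and kf: "k \<notin> {f, - f}" and kg: "k \<notin> {g, - g}"
    and ev: "even (det3 f g k)"
  obtains x y u where "k = x *s f + y *s g + det3 f g k *s u" "\<bar>x\<bar> = 1" "\<bar>y\<bar> = 1"
proof -
  obtain u where u: "det3 f g u = 1" "\<bar>det3 f k u\<bar> \<le> 2" "\<bar>det3 k g u\<bar> \<le> 2"
    using completion [of f g] entry_le_1 [OF F(1)] entry_le_1 [OF F(2)] entry_le_1 [OF F(3)] odd_entry [OF F(1)] odd_entry [OF F(2)]
      odd_difference [OF F(1,2) gf] by blast
  have k: "k = det3 k g u *s f + det3 f k u *s g + det3 f g k *s u"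
    using cramer [of f g u k] u(1) by simp
  have ki: "k$i = det3 k g u * f$i + det3 f k u * g$i + det3 f g k * u$i" for i
    using arg_cong [OF k, of "\<lambda>v. v$i"] by simp
  have ox: "odd (det3 k g u)"
  proof
    assume e: "even (det3 k g u)"
    obtain i where i: "odd (k$i)" using odd_entry F by blast
    obtain j where j: "odd (g$j - k$j)" using odd_difference [OF F(2,3) kg] by blast
    from i e ev have "odd (det3 f k u)" unfolding ki [of i] by auto
    with j e ev show False unfolding ki [of j] by auto
  qed
  have oy: "odd (det3 f k u)"
  proof
    assume e: "even (det3 f k u)"
    obtain j where j: "odd (f$j - k$j)" using odd_difference [OF F(1,3) kf] by blast
    with e ev ox show False unfolding ki [of j] by auto
  qed
  have "odd x \<Longrightarrow> \<bar>x\<bar> \<le> 2 \<Longrightarrow> \<bar>x\<bar> = 1" for x :: int by presburger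
  then have "\<bar>det3 k g u\<bar> = 1" "\<bar>det3 f k u\<bar> = 1" using ox oy u(2,3) by blast+
  then show thesis by (rule that [OF k])
qed

lemma even_sum:
  assumes F: "f \<in> F" "g \<in> F" "k \<in> F" and "g \<notin> {f, - f}" and "k \<notin> {f, - f}" and "k \<notin> {g, - g}"
    and ev: "even (det3 f g k)"
  shows "even (f$i + g$i + k$i)"
proof -
  obtain x y u where k: "k = x *s f + y *s g + det3 f g k *s u" and xy: "\<bar>x\<bar> = 1" "\<bar>y\<bar> = 1"
    using even_combination assms by metis
  have ki: "k$i = x * f$i + y * g$i + det3 f g k * u$i"
    using arg_cong [OF k, of "\<lambda>v. v$i"] by simp
  have "odd x" "odd y" using xy by presburger+
  then show ?thesis unfolding ki using ev by auto
qed

text \<open>Both coefficients are \<open>\<plusminus> 1\<close>, so only the diagonals of the parallelogram with sides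
  \<open>f\<close>, \<open>g\<close> are possible. They exclude each other, since they agree modulo 2
  (\<open>sum_not_diff\<close>).\<close>

lemma coplanar:
  assumes F: "f \<in> F" "g \<in> F" "k \<in> F" and "g \<notin> {f, - f}" and "k \<notin> {f, - f}" and "k \<notin> {g, - g}"
    and "det3 f g k = 0"
  shows "k \<in> {f + g, - (f + g), f - g, - (f - g)}"
proof -
  obtain x y u where k: "k = x *s f + y *s g + det3 f g k *s u" and xy: "\<bar>x\<bar> = 1" "\<bar>y\<bar> = 1"
    using even_combination [OF F] assms by (metis dvd_0_right)
  have k': "k = x *s f + y *s g" using k assms(7) by simp
  have m: "(-1) *s v = - v" for v :: label by (simp add: vec_eq_3)
  from xy have "x = 1 \<or> x = -1" "y = 1 \<or> y = -1" by auto
  then show ?thesis unfolding k' by (elim disjE) (simp_all add: m)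
qed

lemma sum_not_diff:
  assumes F: "f \<in> F" "g \<in> F" "f + g \<in> F" "f - g \<in> F"
  shows False
proof -
  have "even ((f + g)$i - (f - g)$i)" for i by simp
  then have "f - g = f + g \<or> f - g = - (f + g)"
    using odd_difference [OF F(3,4)] by auto
  moreover have "f \<noteq> 0" "g \<noteq> 0" using adm F by (auto simp: admissible_def)
  ultimately show False by (auto simp: vec_eq_3)
qed

lemma collinear_case:
  assumes "f \<in> F" "F \<subseteq> {f, - f}"
  shows "unimodular_image chain_labels F"
proof -
  have F: "F = {f, - f}" using assms minus by blast
  obtain i where "odd (f$i)" using odd_entry assms by blast
  moreover have "\<bar>f$i\<bar> \<le> 1" using entry_le_1 assms by blast
  ultimately have "\<bar>f$i\<bar> = 1" by presburger
  then have *: "\<bar>f$1\<bar> = 1 \<or> \<bar>f$2\<bar> = 1 \<or> \<bar>f$3\<bar> = 1" using exhaust_3 [of i] by auto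
  obtain y z where "\<bar>det3 f y z\<bar> = 1"
    using * that [of "vector [0,1,0]" "vector [0,0,1]"] that [of "vector [1,0,0]" "vector [0,0,1]"]
      that [of "vector [1,0,0]" "vector [0,1,0]"] by (auto simp: det3_expand)
  then show ?thesis
    by (rule unimodular_imageI) (auto simp: F sym_closure_def chain_labels_def)
qed

lemma planar_case:
  assumes F: "f \<in> F" "g \<in> F" and gf: "g \<notin> {f, - f}"
    and zero: "\<And>k. k \<in> F \<Longrightarrow> det3 f g k = 0"
  shows "unimodular_image square_labels F \<or> unimodular_image triangle_labels F"
proof -
  obtain u where "det3 f g u = 1"
    using completion [of f g] entry_le_1 [OF F(1)] entry_le_1 [OF F(2)] odd_entry [OF F(1)] odd_entry [OF F(2)]
      odd_difference [OF F(1,2) gf] by blast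
  moreover have "det3 f (- g) u = - det3 f g u" by (simp add: det3_expand algebra_simps)
  ultimately have u: "\<bar>det3 f g u\<bar> = 1" "\<bar>det3 f (- g) u\<bar> = 1" by simp_all
  have sub: "F \<subseteq> {f, - f, g, - g, f + g, - (f + g), f - g, - (f - g)}"
    using coplanar [OF F _ gf] zero by blast
  have m: "- f \<in> F" "- g \<in> F" using F minus by auto
  have m1: "f + g \<in> F \<longleftrightarrow> - (f + g) \<in> F" "f - g \<in> F \<longleftrightarrow> - (f - g) \<in> F"
    using minus by (metis minus_minus)+
  consider "F = {f, g, - f, - g}" | "F = {f, g, f + g, - f, - g, - (f + g)}" | "F = {f, - g, f - g, - f, g, - (f - g)}"
    using sub m m1 F sum_not_diff [OF F] by blast
  then show ?thesis
  proof cases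
    case 1
    have "unimodular_image square_labels F"
      by (rule unimodular_imageI [OF u(1)]) (simp add: 1 sym_closure_def square_labels_def insert_commute)
    then show ?thesis ..
  next
    case 2
    have "unimodular_image triangle_labels F"
      by (rule unimodular_imageI [OF u(1)]) (simp add: 2 sym_closure_def triangle_labels_def insert_commute)
    then show ?thesis ..
  next
    case 3
    have "unimodular_image triangle_labels F"
      by (rule unimodular_imageI [OF u(2)]) (simp add: 3 sym_closure_def triangle_labels_def insert_commute)
    then show ?thesis ..
  qed
qed

text \<open>The sum of three labels with even determinant is twice a lattice vector \<open>w\<close>, and
  \<open>f, g, w\<close> is a basis because the determinant cannot be \<open>\<plusminus> 4\<close>. A fourth label
  \<open>k\<close> would have odd determinant with each pair, hence \<open>\<plusminus> 3\<close>, and Cramer's rule in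
  the basis \<open>f, g, w\<close> would make all entries of \<open>k\<close> divisible by 3. In the basis
  \<open>w - h, w - g, w - f\<close> the three labels are the face diagonals of the unit cube.\<close>

lemma even_case:
  assumes F: "f \<in> F" "g \<in> F" "h \<in> F" and ev: "even (det3 f g h)" and nz: "det3 f g h \<noteq> 0"
  shows "F = {f, g, h, - f, - g, - h}" "unimodular_image double_cubic_labels F"
proof -
  have gf: "g \<notin> {f, - f}" and hf: "h \<notin> {f, - f}" and hg: "h \<notin> {g, - g}"
    using nz by (auto simp: det3_expand algebra_simps)
  have es: "even (f$i + g$i + h$i)" for i using even_sum [OF F gf hf hg ev] .
  define w where "w = (\<chi> i. (f$i + g$i + h$i) div 2)"
  have w: "f + g + h = 2 *s w" using es by (simp add: w_def vec_eq_iff)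
  then have h: "h = 2 *s w - f - g" by (simp add: algebra_simps)
  have "det3 f g h = 2 * det3 f g w" by (simp add: h det3_expand algebra_simps)
  moreover have "\<bar>det3 f g h\<bar> \<le> 3" using det3_le_3 es entry_le_1 F by blast
  ultimately have D: "\<bar>det3 f g w\<bar> = 1" using nz by presburger
  show F6: "F = {f, g, h, - f, - g, - h}"
  proof (rule ccontr)
    assume "F \<noteq> {f, g, h, - f, - g, - h}"
    then obtain k where k: "k \<in> F" "k \<notin> {f, - f}" "k \<notin> {g, - g}" "k \<notin> {h, - h}"
      using F minus by blast
    \<comment> \<open>An even determinant with a pair would make \<open>k\<close> agree modulo 2 with the third label.\<close>
    have three: "3 dvd det3 x y k"
      if xyz: "x \<in> F" "y \<in> F" "z \<in> F" "y \<notin> {x, - x}" "k \<notin> {x, - x}" "k \<notin> {y, - y}" "k \<notin> {z, - z}"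
        and s: "\<And>i. even (x$i + y$i + z$i)" for x y z
    proof -
      have "odd (det3 x y k)"
      proof
        assume e: "even (det3 x y k)"
        have "even (z$i - k$i)" for i
          using even_sum [OF xyz(1,2) k(1) xyz(4-6) e, of i] s [of i] by presburger
        then show False using odd_difference [OF xyz(3) k(1) xyz(7)] by blast
      qed
      moreover have "\<bar>det3 x y k\<bar> \<noteq> 1" using no_unimodular xyz k(1) by blast
      moreover have "\<bar>det3 x y k\<bar> \<le> 4" using det3_le_4 entry_le_1 xyz k(1) by blast
      ultimately show ?thesis by presburger
    qed
    have e2: "even (f$i + h$i + g$i)" "even (g$i + h$i + f$i)" for i using es [of i] by presburger+
    have t1: "3 dvd det3 f g k" using three [OF F gf k(2,3,4)] es by blast
    have t2: "3 dvd det3 f h k" using three [OF F(1,3,2) hf k(2,4,3)] e2(1) by blast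
    have t3: "3 dvd det3 g h k" using three [OF F(2,3,1) hg k(3,4,2)] e2(2) by blast
    have a1: "2 * det3 k g w = det3 g h k - det3 f g k"
      and a2: "2 * det3 f k w = - det3 f g k - det3 f h k"
      by (simp_all add: h det3_expand algebra_simps)
    have d1: "3 dvd det3 k g w" using a1 t1 t3 by presburger
    have d2: "3 dvd det3 f k w" using a2 t1 t2 by presburger
    have "3 dvd det3 f g w * k$i" for i
    proof -
      have "det3 f g w * k$i = det3 k g w * f$i + det3 f k w * g$i + det3 f g k * w$i"
        using arg_cong [OF cramer [of f g w k], of "\<lambda>v. v$i"] by simp
      then show ?thesis using d1 d2 t1 by (metis dvd_add dvd_mult2)
    qed
    moreover have "det3 f g w = 1 \<or> det3 f g w = -1" using D by auto
    ultimately have "\<forall>i. 3 dvd k$i" by auto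
    then show False using nonzero_mod_3 k(1) by blast
  qed
  have "det3 (w - h) (w - g) (w - f) = - det3 f g w"
    by (simp add: h det3_expand algebra_simps)
  then have D': "\<bar>det3 (w - h) (w - g) (w - f)\<bar> = 1" using D by simp
  have e: "(w - h) + (w - g) = f" "(w - h) + (w - f) = g" "(w - g) + (w - f) = h"
    by (simp_all add: h vec_eq_3)
  show "unimodular_image double_cubic_labels F"
    by (rule unimodular_imageI [OF D']) (simp add: F6 sym_closure_def double_cubic_labels_def e insert_commute)
qed

text \<open>Labels in the cube are determined by their residues modulo 3,
  so a label that depends on \<open>f\<close> and \<open>g\<close> modulo 3 needs both of them; choosing
  signs makes the sum divisible by 3.\<close>

lemma mod_3_combination:
  assumes F: "f \<in> F" "g \<in> F" "k \<in> F" and gf: "g \<notin> {f, - f}" and kf: "k \<notin> {f, - f}" and kg: "k \<notin> {g, - g}"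
    and three: "3 dvd det3 f g k"
  obtains f' g' where "f' \<in> {f, - f}" "g' \<in> {g, - g}" "\<forall>i. 3 dvd f'$i + g'$i + k$i"
proof -
  obtain u where u: "det3 f g u = 1"
    using completion [of f g] entry_le_1 [OF F(1)] entry_le_1 [OF F(2)] odd_entry [OF F(1)] odd_entry [OF F(2)]
      odd_difference [OF F(1,2) gf] by blast
  define x y where "x = det3 k g u" and "y = det3 f k u"
  have k: "k = x *s f + y *s g + det3 f g k *s u"
    using cramer [of f g u k] u(1) by (simp add: x_def y_def)
  have ki: "k$i = x * f$i + y * g$i + det3 f g k * u$i" for i
    using arg_cong [OF k, of "\<lambda>v. v$i"] by simp
  obtain d where d: "det3 f g k = 3 * d" using three by blast
  have rem: "\<exists>s e. z = s + 3 * e \<and> (s = 0 \<or> s = 1 \<or> s = -1)" for z :: int by presburger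
  obtain s e where s: "x = s + 3 * e" "s = 0 \<or> s = 1 \<or> s = -1" using rem by blast
  obtain t e' where t: "y = t + 3 * e'" "t = 0 \<or> t = 1 \<or> t = -1" using rem by blast
  have dv: "3 dvd k$i - s * f$i - t * g$i" for i
  proof -
    have "k$i - s * f$i - t * g$i = 3 * (e * f$i + e' * g$i + d * u$i)"
      unfolding ki d s t by (simp add: algebra_simps)
    then show ?thesis by simp
  qed
  have neq: "k \<noteq> v" if "v \<in> {f, - f, g, - g}" for v using that kf kg by auto
  have inj: "\<not> (\<forall>i. 3 dvd k$i - v$i)" if "v \<in> {f, - f, g, - g}" for v
    using cube_mod_3_inject [of k v] entry_le_1 F minus neq that by blast
  have "s \<noteq> 0"
  proof
    assume "s = 0"
    with t(2) dv show False
      using inj [of g] inj [of "- g"] nonzero_mod_3 [OF F(3)] by auto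
  qed
  moreover have "t \<noteq> 0"
  proof
    assume "t = 0"
    with s(2) dv show False
      using inj [of f] inj [of "- f"] nonzero_mod_3 [OF F(3)] by auto
  qed
  ultimately have "s *s f \<in> {f, - f}" "t *s g \<in> {g, - g}"
    using s t by (auto simp: vec_eq_3)
  moreover have "- f - - f = 0" by simp
  ultimately show thesis
    using that [of "- (s *s f)" "- (t *s g)"] dv by (auto simp: algebra_simps)
qed

text \<open>The basis \<open>w - f, w, w - g\<close> is one in which the labels \<open>f\<close>, \<open>g\<close> and
  \<open>h\<close> have entries in \<open>{-1, 0, 1}\<close>.\<close>

lemma triple_normal_form:
  assumes D: "\<bar>det3 f g w\<bar> = 1" and h: "h = 3 *s w - f - g"
  shows "F = {f, g, h, - f, - g, - h} \<Longrightarrow> unimodular_image triple_cubic_labels F"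
    and "F = {f, g, h, f - g, - f, - g, - h, - (f - g)} \<Longrightarrow> unimodular_image triple_prism_labels F"
proof -
  have "det3 (w - f) w (w - g) = - det3 f g w"
    by (simp add: det3_expand algebra_simps)
  then have D': "\<bar>det3 (w - f) w (w - g)\<bar> = 1" using D by simp
  let ?c = "\<lambda>c :: label. c$1 *s (w - f) + c$2 *s w + c$3 *s (w - g)"
  have e: "?c (vector [-1,1,0]) = f" "?c (vector [0,1,-1]) = g" "?c (vector [1,1,1]) = h" "?c (vector [-1,0,1]) = f - g"
    by (simp_all add: h vec_eq_3)
  show "unimodular_image triple_cubic_labels F" if "F = {f, g, h, - f, - g, - h}"
    by (rule unimodular_imageI [OF D'])
      (simp only: that sym_closure_def triple_cubic_labels_def image_insert image_empty e, blast)
  show "unimodular_image triple_prism_labels F" if "F = {f, g, h, f - g, - f, - g, - h, - (f - g)}"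
    by (rule unimodular_imageI [OF D'])
      (simp only: that sym_closure_def triple_prism_labels_def image_insert image_empty e, blast)
qed

text \<open>After sign changes the labels satisfy \<open>f + g + h = 3w\<close> and \<open>f, g, w\<close> is a basis.
  Each further label is \<open>q f + r g + p h\<close> up to sign, where \<open>3p\<close>, \<open>3q\<close>,
  \<open>3r\<close> are determinants, so \<open>p, q, r\<close> lie in \<open>{-1, 0, 1}\<close>. If two of them
  agree, the label is congruent modulo 3 to a multiple of a single one of the three labels, and therefore
  equal to it up to sign or zero. So it is a difference of two of the three labels. The three differences are
  congruent modulo 3, so only one of them occurs, and a cyclic shift makes it \<open>f - g\<close>.\<close>

lemma triple_case:
  assumes F: "f \<in> F" "g \<in> F" "h \<in> F" and nz: "det3 f g h \<noteq> 0"
    and three: "\<And>f g h. f \<in> F \<Longrightarrow> g \<in> F \<Longrightarrow> h \<in> F \<Longrightarrow> det3 f g h \<in> {0, 3, - 3}"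
  shows "unimodular_image triple_cubic_labels F \<or> unimodular_image triple_prism_labels F"
proof -
  have three_dvd: "3 dvd det3 x y z" if "x \<in> F" "y \<in> F" "z \<in> F" for x y z
    using three [OF that] by auto
  have ind: "g \<notin> {f, - f}" "h \<notin> {f, - f}" "h \<notin> {g, - g}"
    using nz by (auto simp: det3_expand algebra_simps)
  obtain f' g' where f': "f' \<in> {f, - f}" and g': "g' \<in> {g, - g}" and s3: "\<forall>i. 3 dvd f'$i + g'$i + h$i"
    using mod_3_combination [OF F ind three_dvd [OF F]] .
  have F': "f' \<in> F" "g' \<in> F" using f' g' F minus by auto
  define w where "w = (\<chi> i. (f'$i + g'$i + h$i) div 3)"
  have w: "f' + g' + h = 3 *s w" using s3 by (simp add: w_def vec_eq_iff)
  then have h: "h = 3 *s w - f' - g'" by (simp add: algebra_simps)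
  have "\<bar>det3 f' g' h\<bar> = \<bar>det3 f g h\<bar>"
    using f' g' by (auto simp: det3_expand abs_if algebra_simps)
  moreover have "det3 f' g' h = 3 * det3 f' g' w" by (simp add: h det3_expand algebra_simps)
  ultimately have D: "\<bar>det3 f' g' w\<bar> = 1" using nz three [OF F] by auto
  let ?T = "{f', g', h, - f', - g', - h}"
  have sub: "?T \<subseteq> F" using F' F minus by blast
  show ?thesis
  proof (cases "F = ?T")
    case True
    then show ?thesis using triple_normal_form [OF D h] by blast
  next
    case False
    have extra: "k \<in> {f' - g', - (f' - g'), g' - h, - (g' - h), h - f', - (h - f')}"
      if k: "k \<in> F" "k \<notin> ?T" for k
    proof -
      obtain p where p: "det3 f' g' k = 3 * p" "\<bar>p\<bar> \<le> 1" using three [OF F' k(1)] by fastforce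
      obtain q where q: "det3 g' h k = 3 * q" "\<bar>q\<bar> \<le> 1" using three [OF F'(2) F(3) k(1)] by fastforce
      obtain r where r: "det3 h f' k = 3 * r" "\<bar>r\<bar> \<le> 1" using three [OF F(3) F'(1) k(1)] by fastforce
      have "3 * det3 k g' w = det3 g' h k - det3 f' g' k"
        and "3 * det3 f' k w = det3 h f' k - det3 f' g' k"
        by (simp_all add: h det3_expand algebra_simps)
      then have X: "det3 k g' w = q - p" "det3 f' k w = r - p" using p q r by simp_all
      have "det3 f' g' w *s k = (q - p) *s f' + (r - p) *s g' + (3 * p) *s w"
        using cramer [of f' g' w k] by (simp add: X p)
      also have "\<dots> = q *s f' + r *s g' + p *s h"
        by (simp add: h vec_eq_3 algebra_simps)
      finally have E: "det3 f' g' w *s k = q *s f' + r *s g' + p *s h" .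
      define k' where "k' = det3 f' g' w *s k"
      have k': "k' \<in> F" "k' \<notin> ?T" "k \<in> {k', - k'}"
      proof -
        have "det3 f' g' w = 1 \<or> det3 f' g' w = - 1" using D by auto
        then have "k' = k \<or> k' = - k" by (auto simp: k'_def vec_eq_3)
        moreover have "- x \<in> ?T" if "x \<in> ?T" for x using that by (elim insertE emptyE) simp_all
        then have "- k \<notin> ?T" using k(2) by (metis minus_minus)
        moreover have "- k \<in> F" "k \<in> {- k, - (- k)}" using k(1) minus by simp_all
        ultimately show "k' \<in> F" "k' \<notin> ?T" "k \<in> {k', - k'}" using k by (metis insertI1)+
      qed
      have E: "k' = q *s f' + r *s g' + p *s h" using E by (simp add: k'_def)
      have inj: "\<not> (\<forall>i. 3 dvd k'$i - v$i)" if "v \<in> ?T" for v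
        using cube_mod_3_inject [of k' v] entry_le_1 sub k' that by blast
      have nz3: "\<not> (\<forall>i. 3 dvd k'$i)" using nonzero_mod_3 k' by blast
      have hi: "h$i = 3 * w$i - f'$i - g'$i" for i by (simp add: h)
      have di: "k'$i = q * f'$i + r * g'$i + p * h$i" for i by (simp add: E)
      \<comment> \<open>A combination that is, modulo 3, a multiple of a single label is excluded.\<close>
      have no: False if v: "v \<in> {f', g', h}" and e: "\<And>i. k'$i = 3 * a * w$i + c * v$i" for v a c
      proof -
        have "\<exists>s e. c = s + 3 * e \<and> (s = 0 \<or> s = 1 \<or> s = -1)" by presburger
        then obtain s e where s: "c = s + 3 * e" "s = 0 \<or> s = 1 \<or> s = -1" by blast
        have "k'$i - s * v$i = 3 * (a * w$i + e * v$i)" for i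
          unfolding assms e s(1) by (simp add: algebra_simps)
        then have "3 dvd k'$i - s * v$i" for i by simp
        then show False using s(2) nz3 inj [of v] inj [of "- v"] v by auto
      qed
      have "q \<noteq> r" using no [of h q "p - q"] by (auto simp: di hi algebra_simps)
      moreover have "q \<noteq> p" using no [of g' q "r - q"] by (auto simp: di hi algebra_simps)
      moreover have "r \<noteq> p" using no [of f' r "q - r"] by (auto simp: di hi algebra_simps)
      moreover have "x = -1 \<or> x = 0 \<or> x = 1" if "\<bar>x\<bar> \<le> 1" for x :: int using that by auto
      ultimately have perm: "(q, r, p) \<in> {(1,-1,0), (-1,1,0), (0,1,-1), (0,-1,1), (-1,0,1), (1,0,-1)}"
        using p(2) q(2) r(2) by (smt (verit) insertI1 insertI2)
      have "k' \<in> {f' - g', - (f' - g'), g' - h, - (g' - h), h - f', - (h - f')}"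
      proof -
        have m: "(-1) *s v = - v" for v :: label by (simp add: vec_eq_3)
        show ?thesis using perm unfolding E by (auto simp: m)
      qed
      then show ?thesis using k'(3) by auto
    qed
    obtain k where k: "k \<in> F" "k \<notin> ?T" using False sub by blast
    have m3: "\<exists>s\<in>{1,-1}. \<forall>i. 3 dvd l$i - s * (f'$i - g'$i)" if l: "l \<in> F" "l \<notin> ?T" for l
    proof -
      have d: "3 dvd g'$i - h$i - 1 * (f'$i - g'$i)" "3 dvd h$i - f'$i - 1 * (f'$i - g'$i)" for i
        by (rule dvdI [of _ _ "g'$i - w$i"], simp add: h) (rule dvdI [of _ _ "w$i - f'$i"], simp add: h)
      have "- a - - 1 * b = - (a - 1 * b)" for a b :: int by simp
      then have d': "3 dvd - (g'$i - h$i) - - 1 * (f'$i - g'$i)" "3 dvd - (h$i - f'$i) - - 1 * (f'$i - g'$i)" for i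
        using d by (simp_all only: dvd_minus_iff)
      from extra [OF l] consider "l = f' - g'" | "l = - (f' - g')" | "l = g' - h" | "l = - (g' - h)" | "l = h - f'" | "l = - (h - f')"
        by blast
      then show ?thesis
      proof cases
        case 3 show ?thesis unfolding 3 vector_minus_component vector_uminus_component using d(1) by blast
      next
        case 4 show ?thesis unfolding 4 vector_minus_component vector_uminus_component using d'(1) by blast
      next
        case 5 show ?thesis unfolding 5 vector_minus_component vector_uminus_component using d(2) by blast
      next
        case 6 show ?thesis unfolding 6 vector_minus_component vector_uminus_component using d'(2) by blast
      qed simp_all
    qed
    have uniq: "l \<in> {k, - k}" if l: "l \<in> F" "l \<notin> ?T" for l
    proof -
      obtain s where s: "s \<in> {1, - 1 :: int}" "\<forall>i. 3 dvd k$i - s * (f'$i - g'$i)" using m3 k by blast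
      obtain t where t: "t \<in> {1, - 1 :: int}" "\<forall>i. 3 dvd l$i - t * (f'$i - g'$i)" using m3 l by blast
      have "(\<forall>i. 3 dvd l$i - k$i) \<or> (\<forall>i. 3 dvd l$i - (- k)$i)"
      proof (cases "s = t")
        case True
        have "3 dvd l$i - k$i" for i
          using dvd_diff [OF t(2) [rule_format, of i] s(2) [rule_format, of i]] True by simp
        then show ?thesis by blast
      next
        case False
        then have "t = - s" using s t by auto
        then have "3 dvd l$i - (- k)$i" for i
          using dvd_add [OF t(2) [rule_format, of i] s(2) [rule_format, of i]] by simp
        then show ?thesis by blast
      qed
      then show ?thesis
        using cube_mod_3_inject entry_le_1 l(1) k(1) minus by blast
    qed
    have Fk: "F = ?T \<union> {k, - k}" using sub k minus uniq by blast
    have rot: "det3 g' h w = det3 f' g' w" "det3 h f' w = det3 f' g' w"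
      by (simp_all add: h det3_expand algebra_simps)
    have hh: "f' = 3 *s w - g' - h" "g' = 3 *s w - h - f'" by (simp_all add: h)
    have ins: "F = ?T \<union> {d, - d}" if "k \<in> {d, - d}" for d using Fk that by auto
    from extra [OF k] consider "k \<in> {f' - g', - (f' - g')}" | "k \<in> {g' - h, - (g' - h)}" | "k \<in> {h - f', - (h - f')}"
      by blast
    then have "unimodular_image triple_prism_labels F"
    proof cases
      case 1
      show ?thesis by (rule triple_normal_form(2) [OF D h]) (use ins [OF 1] in blast)
    next
      case 2
      have "\<bar>det3 g' h w\<bar> = 1" using D rot(1) by simp
      then show ?thesis by (rule triple_normal_form(2) [OF _ hh(1)]) (use ins [OF 2] in blast)
    next
      case 3
      have "\<bar>det3 h f' w\<bar> = 1" using D rot(2) by simp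
      then show ?thesis by (rule triple_normal_form(2) [OF _ hh(2)]) (use ins [OF 3] in blast)
    qed
    then show ?thesis ..
  qed
qed

theorem label_set_classification:
  "\<exists>C\<in>{chain_labels, square_labels, triangle_labels, double_cubic_labels, triple_cubic_labels, triple_prism_labels}.
     unimodular_image C F"
proof -
  obtain f where f: "f \<in> F" using adm by (auto simp: admissible_def)
  show ?thesis
  proof (cases "\<exists>x\<in>F. \<exists>y\<in>F. \<exists>z\<in>F. det3 x y z \<noteq> 0")
    case False
    show ?thesis
    proof (cases "F \<subseteq> {f, - f}")
      case True
      then show ?thesis using collinear_case [OF f] by blast
    next
      case ne: False
      then obtain g where g: "g \<in> F" "g \<notin> {f, - f}" by blast
      have "unimodular_image square_labels F \<or> unimodular_image triangle_labels F"
        by (rule planar_case [OF f g]) (use False f g in blast)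
      then show ?thesis by blast
    qed
  next
    case nonzero: True
    show ?thesis
    proof (cases "\<exists>x\<in>F. \<exists>y\<in>F. \<exists>z\<in>F. det3 x y z \<noteq> 0 \<and> even (det3 x y z)")
      case True
      then obtain x y z where "x \<in> F" "y \<in> F" "z \<in> F" "even (det3 x y z)" "det3 x y z \<noteq> 0" by blast
      then have "unimodular_image double_cubic_labels F" by (rule even_case)
      then show ?thesis by blast
    next
      case False
      have three: "det3 x y z \<in> {0, 3, - 3}" if "x \<in> F" "y \<in> F" "z \<in> F" for x y z
      proof -
        have "det3 x y z = 0 \<or> odd (det3 x y z)" using False that by blast
        moreover have "\<bar>det3 x y z\<bar> \<noteq> 1" by (rule no_unimodular [OF that])
        moreover have "\<bar>det3 x y z\<bar> \<le> 4" using that by (intro det3_le_4 entry_le_1)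
        ultimately have "det3 x y z = 0 \<or> det3 x y z = 3 \<or> det3 x y z = - 3" by presburger
        then show ?thesis by simp
      qed
      obtain x y z where "x \<in> F" "y \<in> F" "z \<in> F" "det3 x y z \<noteq> 0" using nonzero by blast
      then have "unimodular_image triple_cubic_labels F \<or> unimodular_image triple_prism_labels F"
        by (rule triple_case) (rule three)
      then show ?thesis by blast
    qed
  qed
qed

end

section \<open>Lattice nets\<close>

text \<open>Rewriting equations between edges into equations between sets of endpoints interferes with the
  membership of edges in nets, so this is done explicitly.\<close>

declare closed_segment_eq [simp del]

definition real_vec :: "label \<Rightarrow> pt" where
  "real_vec k = (\<chi> i. of_int (k$i))"

text \<open>A translation by a label is a translation by the value of this map at an integer vector; the real
  coordinates serve to describe the interior points of an edge.\<close>

definition frame :: "(3 \<Rightarrow> pt) \<Rightarrow> pt \<Rightarrow> pt" where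
  "frame a v = (\<Sum>i\<in>UNIV. v$i *\<^sub>R a i)"

lemma real_vec_simps [simp]:
  "real_vec k $ i = of_int (k$i)" "real_vec 0 = 0" "real_vec (k + l) = real_vec k + real_vec l"
  "real_vec (k - l) = real_vec k - real_vec l" "real_vec (- k) = - real_vec k"
  by (simp_all add: real_vec_def vec_eq_iff)

lemma real_vec_eq_iff [simp]: "real_vec k = real_vec l \<longleftrightarrow> k = l"
  by (simp add: vec_eq_iff)

lemma linear_frame: "linear (frame a)"
  unfolding frame_def
  by (rule linearI) (simp_all add: scaleR_left_distrib sum.distrib scaleR_right.sum)

lemma translation_frame: "translation a k x = x + frame a (real_vec k)"
  by (simp add: translation_def frame_def)

lemma translation_0 [simp]: "translation a 0 x = x"
  by (simp add: translation_def)

lemma translation_add: "translation a (k + l) x = translation a k (translation a l x)"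
  by (simp add: translation_frame linear_add [OF linear_frame])

lemma translation_group_iff: "g \<in> translation_group a \<longleftrightarrow> (\<exists>k. g = translation a k)"
  by (auto simp: translation_group_def)

lemma frame_inj:
  assumes "is_basis a" shows "inj (frame a)"
  unfolding linear_injective_0 [OF linear_frame]
proof (intro allI impI)
  fix v assume v: "frame a v = 0"
  have a: "inj a" "independent (range a)" using assms by (auto simp: is_basis_def)
  have "(\<Sum>y\<in>range a. v$(inv a y) *\<^sub>R y) = 0"
    using v a(1) by (simp add: sum.reindex frame_def)
  then have "v$(inv a (a i)) = 0" for i
    using independentD [OF a(2), of "range a" "\<lambda>y. v$(inv a y)" "a i"] by simp
  then show "v = 0" using a(1) by (simp add: vec_eq_iff)
qed

lemma translation_eq_iff [simp]:
  "is_basis a \<Longrightarrow> translation a k x = translation a l x \<longleftrightarrow> k = l"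
  using frame_inj [of a] by (auto simp: translation_frame inj_eq)

lemma is_basis_if_spanning:
  assumes "\<And>i :: 3. (axis i 1 :: pt) \<in> span (range b)"
  shows "is_basis b"
proof -
  have "v \<in> span (range b)" for v :: pt
  proof -
    have "v = (\<Sum>i\<in>UNIV. v$i *\<^sub>R axis i 1)"
      by (simp add: vec_eq_iff axis_def if_distrib cong: if_cong)
    then show ?thesis using assms by (metis (no_types, lifting) span_scale span_sum)
  qed
  then have span: "span (range b) = UNIV" by auto
  have dim: "dim (UNIV :: pt set) = 3" by simp
  have card: "card (range b) \<le> 3" using card_image_le [of UNIV b] by simp
  have ind: "independent (range b)"
    by (rule card_le_dim_spanning [where V = UNIV]) (use span card dim in auto)
  then have "card (range b) = 3" using span dim dim_span_eq_card_independent by metis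
  then have "inj b" by (intro eq_card_imp_inj_on) simp_all
  with ind span show ?thesis by (simp add: is_basis_def)
qed

lemma endpoint_iff [simp]:
  assumes "p \<noteq> q" shows "endpoint x (closed_segment p q) \<longleftrightarrow> x = p \<or> x = q"
proof
  assume "endpoint x (closed_segment p q)"
  then show "x = p \<or> x = q" unfolding endpoint_def closed_segment_eq by (auto simp: doubleton_eq_iff)
next
  assume "x = p \<or> x = q"
  then show "endpoint x (closed_segment p q)"
    unfolding endpoint_def using assms closed_segment_commute [of p q] by metis
qed

lemma translation_segment:
  "translation a k ` closed_segment p q = closed_segment (translation a k p) (translation a k q)"
  using closed_segment_translation [of "frame a (real_vec k)" p q]
  by (simp add: translation_frame [abs_def] add.commute)

text \<open>A net with a single vertex in its quotient graph has a translate of the lattice as nodes, and its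
  edges are all translates of the edges that leave one node. It is thus given by a basis, a node and the
  labels of these edges.\<close>

definition lattice_net :: "(3 \<Rightarrow> pt) \<Rightarrow> pt \<Rightarrow> label set \<Rightarrow> net" where
  "lattice_net a p F =
     (range (\<lambda>k. translation a k p),
      {closed_segment (translation a k p) (translation a (k + f) p) | k f. f \<in> F})"

lemma sym_closure_iff: "f \<in> sym_closure F \<longleftrightarrow> f \<in> F \<or> - f \<in> F"
  unfolding sym_closure_def by (metis Un_iff image_iff minus_minus)

lemma fst_lattice_net: "fst (lattice_net a p F) = range (\<lambda>k. translation a k p)"
  by (simp add: lattice_net_def)

lemma snd_lattice_net_iff: "s \<in> snd (lattice_net a p F) \<longleftrightarrow>
    (\<exists>k f. f \<in> F \<and> s = closed_segment (translation a k p) (translation a (k + f) p))"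
  by (auto simp: lattice_net_def)

lemma lattice_net_edgeI:
  "f \<in> F \<Longrightarrow> closed_segment (translation a k p) (translation a (k + f) p) \<in> snd (lattice_net a p F)"
  unfolding snd_lattice_net_iff by blast

lemma snd_lattice_net: "snd (lattice_net a p F) =
    (\<lambda>(k, f). closed_segment (translation a k p) (translation a (k + f) p)) ` (UNIV \<times> F)"
proof (intro equalityI subsetI)
  fix s assume "s \<in> snd (lattice_net a p F)"
  then obtain k f where "f \<in> F" "s = closed_segment (translation a k p) (translation a (k + f) p)"
    unfolding snd_lattice_net_iff by blast
  then show "s \<in> (\<lambda>(k, f). closed_segment (translation a k p) (translation a (k + f) p)) ` (UNIV \<times> F)"
    by (intro image_eqI [of _ _ "(k, f)"]) auto
qed (clarsimp simp: snd_lattice_net_iff, blast)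

lemma lattice_net_edge_iff:
  assumes "is_basis a"
  shows "closed_segment (translation a k p) (translation a l p) \<in> snd (lattice_net a p F)
     \<longleftrightarrow> l - k \<in> sym_closure F" (is "?L \<longleftrightarrow> ?R")
proof
  assume ?L
  then obtain j f where "f \<in> F" "k = j \<and> l = j + f \<or> k = j + f \<and> l = j"
    using assms by (auto simp: lattice_net_def closed_segment_eq doubleton_eq_iff)
  then show ?R by (auto simp: sym_closure_iff)
next
  assume ?R
  then consider "l - k \<in> F" | "k - l \<in> F" by (auto simp: sym_closure_iff)
  then show ?L
  proof cases
    case 1
    then show ?thesis using lattice_net_edgeI [OF 1, of a k p] by simp
  next
    case 2
    then show ?thesis using lattice_net_edgeI [OF 2, of a l p] by (simp add: closed_segment_commute)
  qed
qed

lemma lattice_net_sym_closure: "lattice_net a p (sym_closure F) = lattice_net a p F"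
proof (rule prod_eqI)
  show "snd (lattice_net a p (sym_closure F)) = snd (lattice_net a p F)"
  proof (intro equalityI subsetI)
    fix s assume "s \<in> snd (lattice_net a p (sym_closure F))"
    then obtain k f where f: "f \<in> F \<or> - f \<in> F"
      and s: "s = closed_segment (translation a k p) (translation a (k + f) p)"
      by (auto simp: snd_lattice_net_iff sym_closure_iff)
    have "s = closed_segment (translation a (k + f) p) (translation a (k + f + - f) p)"
      by (simp add: s closed_segment_commute)
    with f s show "s \<in> snd (lattice_net a p F)" unfolding snd_lattice_net_iff by blast
  qed (auto simp: snd_lattice_net_iff sym_closure_iff)
qed (simp add: fst_lattice_net)

lemma lattice_net_translation:
  "lattice_net a (translation a j p) F = lattice_net a p F"
proof -
  have sub: "fst (lattice_net a (translation a j p) F) \<subseteq> fst (lattice_net a p F)"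
    "snd (lattice_net a (translation a j p) F) \<subseteq> snd (lattice_net a p F)" for j p
  proof -
    show "fst (lattice_net a (translation a j p) F) \<subseteq> fst (lattice_net a p F)"
      by (auto simp: fst_lattice_net simp flip: translation_add)
    show "snd (lattice_net a (translation a j p) F) \<subseteq> snd (lattice_net a p F)"
    proof
      fix s assume "s \<in> snd (lattice_net a (translation a j p) F)"
      then obtain k f where f: "f \<in> F"
        and "s = closed_segment (translation a k (translation a j p)) (translation a (k + f) (translation a j p))"
        by (auto simp: snd_lattice_net_iff)
      then have "s = closed_segment (translation a (k + j) p) (translation a (k + j + f) p)"
        by (simp add: add_ac flip: translation_add)
      with f show "s \<in> snd (lattice_net a p F)" unfolding snd_lattice_net_iff by blast
    qed
  qed
  have "translation a (- j) (translation a j p) = p" by (simp flip: translation_add)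
  then show ?thesis
    using sub [of j p] sub [of "- j" "translation a j p"] by (intro prod_eqI equalityI) auto
qed

lemma translation_lattice_net:
  "translation a j ` fst (lattice_net a p F) = fst (lattice_net a p F)"
  "(`) (translation a j) ` snd (lattice_net a p F) = snd (lattice_net a p F)"
proof -
  have r: "translation a j (translation a k p) = translation a k (translation a j p)" for k
    by (metis translation_add add.commute)
  have "translation a j ` fst (lattice_net a p F) = fst (lattice_net a (translation a j p) F)"
    by (simp add: fst_lattice_net image_image r)
  then show "translation a j ` fst (lattice_net a p F) = fst (lattice_net a p F)"
    by (simp add: lattice_net_translation)
  have "(`) (translation a j) ` snd (lattice_net a p F) = snd (lattice_net a (translation a j p) F)"
    by (simp add: snd_lattice_net image_image case_prod_unfold translation_segment r)
  then show "(`) (translation a j) ` snd (lattice_net a p F) = snd (lattice_net a p F)"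
    by (simp add: lattice_net_translation)
qed

lemma node_orbits_lattice_net: "node_orbits a (lattice_net a p F) = {fst (lattice_net a p F)}"
proof -
  have "{g (translation a k p) | g. g \<in> translation_group a} = fst (lattice_net a p F)" for k
  proof -
    have "{g (translation a k p) | g. g \<in> translation_group a} = fst (lattice_net a (translation a k p) F)"
      by (auto simp: translation_group_def lattice_net_def)
    then show ?thesis by (simp add: lattice_net_translation)
  qed
  then have "node_orbits a (lattice_net a p F) = (\<lambda>k. fst (lattice_net a p F)) ` (UNIV :: label set)"
    unfolding node_orbits_def fst_lattice_net [of a p F] image_image by simp
  then show ?thesis by auto
qed

lemma finite_edge_orbits_lattice_net:
  assumes "finite F" shows "finite (edge_orbits a (lattice_net a p F))"
proof -
  let ?o = "\<lambda>f. range (\<lambda>k. closed_segment (translation a k p) (translation a (k + f) p))"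
  have "{g ` s | g. g \<in> translation_group a} \<in> ?o ` F" if s: "s \<in> snd (lattice_net a p F)" for s
  proof -
    obtain k f where f: "f \<in> F" and s: "s = closed_segment (translation a k p) (translation a (k + f) p)"
      using s unfolding snd_lattice_net_iff by blast
    have "{g ` s | g. g \<in> translation_group a}
        = range (\<lambda>j. translation a j ` s)"
      by (auto simp: translation_group_def)
    also have "\<dots> = range (\<lambda>j. closed_segment (translation a (j + k) p) (translation a (j + k + f) p))"
      by (simp add: s translation_segment translation_add add.assoc)
    also have "\<dots> = ?o f"
    proof -
      have "closed_segment (translation a j p) (translation a (j + f) p)
        = closed_segment (translation a (j - k + k) p) (translation a (j - k + k + f) p)" for j by simp
      then show ?thesis by (fast)
    qed
    finally show ?thesis using f by blast
  qed
  then have "edge_orbits a (lattice_net a p F) \<subseteq> ?o ` F" unfolding edge_orbits_def by blast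
  then show ?thesis using assms finite_surj by blast
qed

lemma periodicity_basis_lattice_net:
  assumes "is_basis a" "finite F" shows "periodicity_basis (lattice_net a p F) a"
  unfolding periodicity_basis_def translation_group_def
  using assms finite_edge_orbits_lattice_net
  by (simp add: node_orbits_lattice_net translation_lattice_net)

section \<open>Nets with a single vertex in the quotient graph\<close>

text \<open>A translation that preserves a net is determined by the image of one node, which is again a node. If
  the nodes form a single orbit, every period is therefore a period of that orbit.\<close>

lemma translation_group_subset:
  assumes "periodicity_basis \<N> b" and N: "fst \<N> = range (\<lambda>k. translation a k p)"
  shows "translation_group b \<subseteq> translation_group a"
proof
  fix g assume g: "g \<in> translation_group b"
  then obtain k where k: "g = translation b k" by (auto simp: translation_group_iff)
  have "p \<in> fst \<N>" unfolding N by (metis rangeI translation_0)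
  then have "g p \<in> fst \<N>" using assms(1) g unfolding periodicity_basis_def by blast
  then obtain l where "g p = translation a l p" unfolding N by blast
  then have "g = translation a l" by (auto simp: k translation_frame)
  then show "g \<in> translation_group a" by (auto simp: translation_group_iff)
qed

lemma primitive_basis_lattice_net:
  assumes "is_basis a" "finite F" shows "primitive_basis (lattice_net a p F) a"
  unfolding primitive_basis_def
  using periodicity_basis_lattice_net [OF assms] translation_group_subset [of "lattice_net a p F" _ a p]
  by (auto simp: lattice_net_def)

text \<open>The definition provides one primitive basis with a single orbit of nodes. Every other period lattice
  is contained in its lattice, and a primitive one is equal to it.\<close>

lemma single_vertex_nodes:
  assumes "single_vertex_quotient_graph \<N>" "primitive_basis \<N> b" "p \<in> fst \<N>"
  shows "fst \<N> = range (\<lambda>k. translation b k p)"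
proof -
  obtain G a q where a: "primitive_basis \<N> a"
    and G: "G = underlying_multigraph (LQG \<N> a q)" "card (mg_verts G) = 1"
    using assms(1) unfolding single_vertex_quotient_graph_def is_quotient_graph_def by blast
  have card: "card (node_orbits a \<N>) = 1"
    using G(2) unfolding G(1) by (simp only: underlying_multigraph_def LQG_def multigraph.select_convs labelled_graph.select_convs)
  have pa: "periodicity_basis \<N> a" using a by (simp add: primitive_basis_def)
  obtain O1 where O1: "node_orbits a \<N> = {O1}" using card_1_singletonE [OF card] .
  have orb: "{g x | g. g \<in> translation_group a} = O1" if "x \<in> fst \<N>" for x
  proof -
    have "{g x | g. g \<in> translation_group a} \<in> node_orbits a \<N>"
      unfolding node_orbits_def by (rule imageI [OF that])
    then show ?thesis unfolding O1 by (rule singletonD)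
  qed
  have "fst \<N> = {g p | g. g \<in> translation_group a}"
  proof
    show "{g p | g. g \<in> translation_group a} \<subseteq> fst \<N>"
      using pa assms(3) unfolding periodicity_basis_def by blast
    show "fst \<N> \<subseteq> {g p | g. g \<in> translation_group a}"
    proof
      fix x assume x: "x \<in> fst \<N>"
      have "x = translation a 0 x" "translation a 0 \<in> translation_group a"
        by (simp_all add: translation_group_def)
      then have "x \<in> {g x | g. g \<in> translation_group a}" by blast
      then show "x \<in> {g p | g. g \<in> translation_group a}"
        unfolding orb [OF x] orb [OF assms(3)] .
    qed
  qed
  then have N: "fst \<N> = range (\<lambda>k. translation a k p)"
    by (auto simp: translation_group_def)
  have "translation_group b \<subseteq> translation_group a"
    using translation_group_subset [OF _ N] assms(2) by (simp add: primitive_basis_def)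
  then have "translation_group b = translation_group a"
    using assms(2) pa unfolding primitive_basis_def by blast
  then have "(\<lambda>g. g p) ` translation_group b = (\<lambda>g. g p) ` translation_group a" by simp
  then show ?thesis unfolding N translation_group_def image_image by simp
qed

definition label_set :: "(3 \<Rightarrow> pt) \<Rightarrow> pt \<Rightarrow> net \<Rightarrow> label set" where
  "label_set a p \<N> = {f. closed_segment p (translation a f p) \<in> snd \<N>}"

context
  fixes \<N> :: net and a p
  assumes proper: "proper_linear_3_periodic_net \<N>" and basis: "periodicity_basis \<N> a"
    and nodes: "fst \<N> = range (\<lambda>k. translation a k p)"
begin

lemma periodicity_is_basis: "is_basis a" using basis by (simp add: periodicity_basis_def)

lemma edge_translation:
  assumes "closed_segment x y \<in> snd \<N>"
  shows "closed_segment (translation a k x) (translation a k y) \<in> snd \<N>"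
proof -
  have "translation a k \<in> translation_group a" by (simp add: translation_group_def)
  then have "(`) (translation a k) ` snd \<N> = snd \<N>"
    using basis unfolding periodicity_basis_def by blast
  then show ?thesis using imageI [OF assms, of "(`) (translation a k)"] by (simp add: translation_segment)
qed

lemma edge_iff_label:
  "closed_segment (translation a k p) (translation a l p) \<in> snd \<N> \<longleftrightarrow> l - k \<in> label_set a p \<N>"
proof
  assume "closed_segment (translation a k p) (translation a l p) \<in> snd \<N>"
  from edge_translation [OF this, of "- k"] show "l - k \<in> label_set a p \<N>"
    by (simp add: label_set_def flip: translation_add)
next
  assume "l - k \<in> label_set a p \<N>"
  then have "closed_segment p (translation a (l - k) p) \<in> snd \<N>" by (simp add: label_set_def)
  from edge_translation [OF this, of k] show "closed_segment (translation a k p) (translation a l p) \<in> snd \<N>"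
    by (simp flip: translation_add)
qed

lemma label_set_minus: "f \<in> label_set a p \<N> \<Longrightarrow> - f \<in> label_set a p \<N>"
  using edge_iff_label [of 0 f] edge_iff_label [of f 0] by (simp add: closed_segment_commute)

lemma eq_lattice_net: "\<N> = lattice_net a p (label_set a p \<N>)"
proof -
  have "snd \<N> = snd (lattice_net a p (label_set a p \<N>))"
  proof (intro equalityI subsetI)
    fix s assume s: "s \<in> snd \<N>"
    then obtain x y where xy: "x \<noteq> y" "s = closed_segment x y"
      using proper by (auto simp: proper_linear_3_periodic_net_def is_segment_def)
    then have "endpoint x s" "endpoint y s" by simp_all
    then have "x \<in> fst \<N>" "y \<in> fst \<N>"
      using proper s unfolding proper_linear_3_periodic_net_def by auto
    then obtain k l where "x = translation a k p" "y = translation a l p" unfolding nodes by blast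
    then show "s \<in> snd (lattice_net a p (label_set a p \<N>))"
      using s xy lattice_net_edge_iff [OF periodicity_is_basis] edge_iff_label by (auto simp: sym_closure_def)
  next
    fix s assume "s \<in> snd (lattice_net a p (label_set a p \<N>))"
    then show "s \<in> snd \<N>"
      by (auto simp: lattice_net_def edge_iff_label)
  qed
  moreover have "fst \<N> = fst (lattice_net a p (label_set a p \<N>))" by (simp add: nodes lattice_net_def)
  ultimately show ?thesis by (rule prod_eqI [rotated])
qed

lemma zero_not_label: "0 \<notin> label_set a p \<N>"
proof
  assume "0 \<in> label_set a p \<N>"
  then have "is_segment (closed_segment p p)"
    using proper by (simp add: label_set_def proper_linear_3_periodic_net_def)
  then show False by (auto simp: is_segment_def closed_segment_eq doubleton_eq_iff simp del: closed_segment_idem)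
qed

lemma label_set_nonempty: "label_set a p \<N> \<noteq> {}"
proof
  assume "label_set a p \<N> = {}"
  then have "snd \<N> = snd (lattice_net a p {})" using eq_lattice_net by simp
  then have "snd \<N> = {}" by (simp add: lattice_net_def)
  then have "fst \<N> = {}" using proper by (simp add: proper_linear_3_periodic_net_def)
  then show False using nodes by simp
qed

text \<open>Periodicity bounds the number of edge orbits, and an orbit determines the label of its edges up to
  sign.\<close>

lemma finite_label_set: "finite (label_set a p \<N>)"
proof -
  define orb where "orb f = {g ` closed_segment p (translation a f p) | g. g \<in> translation_group a}" for f
  have "orb ` label_set a p \<N> \<subseteq> edge_orbits a \<N>"
    unfolding orb_def edge_orbits_def label_set_def by blast
  then have fin: "finite (orb ` label_set a p \<N>)"
    using basis finite_subset by (auto simp: periodicity_basis_def)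
  have orb_eq: "g = f \<or> g = - f" if "orb f = orb g" for f g
  proof -
    have "closed_segment p (translation a g p) = translation a 0 ` closed_segment p (translation a g p)"
      by (simp add: translation_segment)
    then have "closed_segment p (translation a g p) \<in> orb g"
      unfolding orb_def translation_group_def by - (rule CollectI, rule exI, rule conjI, assumption, rule rangeI)
    then have "closed_segment p (translation a g p) \<in> orb f" unfolding that .
    then obtain k where "closed_segment p (translation a g p) = closed_segment (translation a k p) (translation a (k + f) p)"
      unfolding orb_def translation_group_def by (auto simp: translation_segment translation_add)
    then have "{translation a 0 p, translation a g p} = {translation a k p, translation a (k + f) p}"
      by (simp add: closed_segment_eq)
    then have "0 = k \<and> g = k + f \<or> 0 = k + f \<and> g = k"
      unfolding doubleton_eq_iff translation_eq_iff [OF periodicity_is_basis] .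
    then show ?thesis by (auto simp: eq_neg_iff_add_eq_0)
  qed
  have "finite {f \<in> label_set a p \<N>. orb f = y}" for y
  proof (cases "\<exists>f. orb f = y")
    case True
    then obtain f where "orb f = y" by blast
    then have "{f \<in> label_set a p \<N>. orb f = y} \<subseteq> {f, - f}" using orb_eq by blast
    then show ?thesis using finite_subset by blast
  qed simp
  then have "finite (\<Union>y\<in>orb ` label_set a p \<N>. {f \<in> label_set a p \<N>. orb f = y})"
    using fin by blast
  moreover have "label_set a p \<N> \<subseteq> (\<Union>y\<in>orb ` label_set a p \<N>. {f \<in> label_set a p \<N>. orb f = y})"
    by blast
  ultimately show ?thesis by (rule finite_subset [rotated])
qed

end

section \<open>Crossings of edges\<close>

lemma point_of_edge_iff:
  "x \<in> closed_segment (translation a k p) (translation a (k + f) p)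
    \<longleftrightarrow> (\<exists>u. 0 \<le> u \<and> u \<le> 1 \<and> x = p + frame a (real_vec k + u *\<^sub>R real_vec f))"
  unfolding in_segment translation_frame
  by (simp add: linear_add [OF linear_frame] linear_scale [OF linear_frame] algebra_simps)

text \<open>The edges are parametrised by the unit interval. It suffices that each solution of the
  intersection equations has integral parameters and that the first parameter is unique.\<close>

lemma meet_at_endpoint:
  fixes k l f g :: label and p :: pt
  defines "meets \<equiv> \<lambda>(u :: real) (v :: real). 0 \<le> u \<and> u \<le> 1 \<and> 0 \<le> v \<and> v \<le> 1 \<and> (\<forall>i. k$i + u * f$i = l$i + v * (g$i :: real))"
  assumes a: "is_basis a" and f: "f \<noteq> 0" and g: "g \<noteq> 0"
    and ends: "\<And>u v. meets u v \<Longrightarrow> u \<in> {0, 1} \<and> v \<in> {0, 1}"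
    and unique: "\<And>u v u' v'. meets u v \<Longrightarrow> meets u' v' \<Longrightarrow> u = u'"
  defines "s \<equiv> closed_segment (translation a k p) (translation a (k + f) p)"
    and "t \<equiv> closed_segment (translation a l p) (translation a (l + g) p)"
  shows "s \<inter> t = {} \<or> (\<exists>x. s \<inter> t = {x} \<and> endpoint x s \<and> endpoint x t)"
proof -
  have m: "\<exists>u v. meets u v \<and> x = p + frame a (real_vec k + u *\<^sub>R real_vec f) \<and> x = p + frame a (real_vec l + v *\<^sub>R real_vec g)"
    if x: "x \<in> s \<inter> t" for x
  proof -
    obtain u v where u: "0 \<le> u" "u \<le> 1" "x = p + frame a (real_vec k + u *\<^sub>R real_vec f)"
      and v: "0 \<le> v" "v \<le> 1" "x = p + frame a (real_vec l + v *\<^sub>R real_vec g)"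
      using x unfolding s_def t_def Int_iff point_of_edge_iff by blast
    then have "frame a (real_vec k + u *\<^sub>R real_vec f) = frame a (real_vec l + v *\<^sub>R real_vec g)" by simp
    then have "real_vec k + u *\<^sub>R real_vec f = real_vec l + v *\<^sub>R real_vec g"
      by (rule injD [OF frame_inj [OF a]])
    then have "meets u v" using u v by (simp add: meets_def vec_eq_iff)
    with u v show ?thesis by blast
  qed
  have pt: "p + frame a (real_vec k + u *\<^sub>R real_vec f) \<in> {translation a k p, translation a (k + f) p}"
    if "u \<in> {0, 1}" for u k f using that by (auto simp: translation_frame)
  show ?thesis
  proof (cases "s \<inter> t = {}")
    case False
    then obtain x where x: "x \<in> s \<inter> t" by blast
    then obtain u v where uv: "meets u v" "x = p + frame a (real_vec k + u *\<^sub>R real_vec f)"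
      "x = p + frame a (real_vec l + v *\<^sub>R real_vec g)" using m by blast
    have "y = x" if "y \<in> s \<inter> t" for y
      using m [OF that] unique [OF uv(1)] uv(2) by blast
    then have "s \<inter> t = {x}" using x by blast
    moreover have "endpoint x s" "endpoint x t"
      unfolding s_def t_def using a f g pt [of u k f] pt [of v l g] ends [OF uv(1)] uv(2,3) by auto
    ultimately show ?thesis by blast
  qed simp
qed

lemma int_in_unit: "\<bar>m\<bar> = 1 \<Longrightarrow> u * of_int m = (of_int n :: real) \<Longrightarrow> 0 \<le> u \<Longrightarrow> u \<le> 1 \<Longrightarrow> u \<in> {0, 1}"
proof -
  assume m: "\<bar>m\<bar> = 1" and n: "u * of_int m = (of_int n :: real)" and u: "0 \<le> u" "u \<le> 1"
  have "m = 1 \<or> m = - 1" using m by auto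
  then have "u = of_int n \<or> u = of_int (- n)" using n by auto
  then obtain j :: int where j: "u = of_int j" by blast
  with u have "0 \<le> j" "j \<le> 1" by simp_all
  then have "j = 0 \<or> j = 1" by auto
  with j show ?thesis by auto
qed

text \<open>Eliminating one of the parameters with the unit minor expresses the other one as an integer.\<close>

lemma transversal_edges:
  fixes k l f g :: label and p :: pt
  assumes a: "is_basis a" and fg: "\<bar>f$i * g$j - f$j * g$i\<bar> = 1"
  defines "s \<equiv> closed_segment (translation a k p) (translation a (k + f) p)"
    and "t \<equiv> closed_segment (translation a l p) (translation a (l + g) p)"
  shows "s \<inter> t = {} \<or> (\<exists>x. s \<inter> t = {x} \<and> endpoint x s \<and> endpoint x t)"
  unfolding s_def t_def
proof (rule meet_at_endpoint [OF a])
  show "f \<noteq> 0" "g \<noteq> 0" using fg by auto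
  let ?m = "f$i * g$j - f$j * g$i"
  let ?n = "(l$i - k$i) * g$j - (l$j - k$j) * g$i"
  let ?n' = "(l$i - k$i) * f$j - (l$j - k$j) * f$i"
  have eq: "u * of_int ?m = of_int ?n \<and> v * of_int ?m = of_int ?n'"
    if e: "\<forall>i. k$i + u * f$i = l$i + v * (g$i :: real)" for u v :: real
  proof -
    have d: "real_of_int (l$i) - real_of_int (k$i) = u * f$i - v * g$i" for i
      using e [rule_format, of i] by simp
    show ?thesis unfolding of_int_diff of_int_mult d by (simp add: algebra_simps)
  qed
  show "u \<in> {0, 1} \<and> v \<in> {0, 1}"
    if "0 \<le> u \<and> u \<le> 1 \<and> 0 \<le> v \<and> v \<le> 1 \<and> (\<forall>i. k$i + u * f$i = l$i + v * (g$i :: real))" for u v :: real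
    using int_in_unit [OF fg] eq that by blast
  show "u = u'"
    if "0 \<le> u \<and> u \<le> 1 \<and> 0 \<le> v \<and> v \<le> 1 \<and> (\<forall>i. k$i + u * f$i = l$i + v * (g$i :: real))"
      "0 \<le> u' \<and> u' \<le> 1 \<and> 0 \<le> v' \<and> v' \<le> 1 \<and> (\<forall>i. k$i + u' * f$i = l$i + v' * (g$i :: real))" for u v u' v' :: real
  proof -
    have "u * of_int ?m = u' * of_int ?m" using eq that by metis
    moreover have "real_of_int ?m \<noteq> 0" using fg by linarith
    ultimately show ?thesis by simp
  qed
qed

text \<open>In an entry \<open>\<plusminus> 1\<close> of the common label the difference of the parameters is an integer,
  and it is not 0, since then the edges would coincide.\<close>

lemma parallel_edges:
  fixes k l f :: label and p :: pt
  assumes a: "is_basis a" and f: "\<bar>f$i\<bar> = 1" and kl: "k \<noteq> l"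
  defines "s \<equiv> closed_segment (translation a k p) (translation a (k + f) p)"
    and "t \<equiv> closed_segment (translation a l p) (translation a (l + f) p)"
  shows "s \<inter> t = {} \<or> (\<exists>x. s \<inter> t = {x} \<and> endpoint x s \<and> endpoint x t)"
  unfolding s_def t_def
proof (rule meet_at_endpoint [OF a])
  show "f \<noteq> 0" "f \<noteq> 0" using f by auto
  have f1: "f$i = 1 \<or> f$i = - 1" using f by auto
  have eq: "(u, v) = (if l$i - k$i = f$i then (1, 0) else (0, 1))"
    if h: "0 \<le> u \<and> u \<le> 1 \<and> 0 \<le> v \<and> v \<le> 1 \<and> (\<forall>i. k$i + u * f$i = l$i + v * (f$i :: real))" for u v :: real
  proof -
    have e: "(u - v) * f$j = of_int (l$j - k$j)" for j using h by (simp add: algebra_simps)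
    define n where "n = (l$i - k$i) * f$i"
    have n: "u - v = of_int n" using e [of i] f1 by (auto simp: n_def)
    then have "\<bar>n\<bar> \<le> 1" using h by linarith
    moreover have "n \<noteq> 0"
    proof
      assume "n = 0"
      then have "l$j - k$j = 0" for j using e [of j] n by simp
      then show False using kl by (simp add: vec_eq_iff)
    qed
    ultimately have "n = 1 \<or> n = - 1" by auto
    then show ?thesis
    proof
      assume n1: "n = 1"
      then have "l$i - k$i = f$i" using f1 unfolding n_def by auto
      moreover have "u = 1" "v = 0" using n n1 h by auto
      ultimately show ?thesis by simp
    next
      assume n1: "n = - 1"
      then have "l$i - k$i \<noteq> f$i" using f1 unfolding n_def by auto
      moreover have "u = 0" "v = 1" using n n1 h by auto
      ultimately show ?thesis by simp
    qed
  qed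
  show "u \<in> {0, 1} \<and> v \<in> {0, 1}"
    if "0 \<le> u \<and> u \<le> 1 \<and> 0 \<le> v \<and> v \<le> 1 \<and> (\<forall>i. k$i + u * f$i = l$i + v * (f$i :: real))" for u v :: real
    using eq [OF that] by (auto split: if_splits)
  show "u = u'"
    if "0 \<le> u \<and> u \<le> 1 \<and> 0 \<le> v \<and> v \<le> 1 \<and> (\<forall>i. k$i + u * f$i = l$i + v * (f$i :: real))"
      "0 \<le> u' \<and> u' \<le> 1 \<and> 0 \<le> v' \<and> v' \<le> 1 \<and> (\<forall>i. k$i + u' * f$i = l$i + v' * (f$i :: real))" for u v u' v' :: real
    using eq [OF that(1)] eq [OF that(2)] by (auto split: if_splits)
qed

lemma admissible_unit_entry:
  assumes "admissible F" "f \<in> F" obtains i where "\<bar>f$i\<bar> = 1"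
proof -
  have "f \<noteq> 0" using assms by (auto simp: admissible_def)
  then obtain i where "f$i \<noteq> 0" by (auto simp: vec_eq_iff)
  moreover have "\<bar>f$i\<bar> \<le> 1" using assms by (auto simp: admissible_def)
  ultimately show thesis by (intro that [of i]) linarith
qed

lemma essentially_disjoint_lattice_net:
  assumes a: "is_basis a" and F: "admissible F"
  shows "essentially_disjoint (snd (lattice_net a p F))"
  unfolding essentially_disjoint_def
proof (intro ballI impI)
  fix s t assume "s \<in> snd (lattice_net a p F)" "t \<in> snd (lattice_net a p F)" and st: "s \<noteq> t"
  then obtain k f l g where f: "f \<in> F" and s: "s = closed_segment (translation a k p) (translation a (k + f) p)"
    and g: "g \<in> F" and t: "t = closed_segment (translation a l p) (translation a (l + g) p)"
    unfolding snd_lattice_net_iff by blast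
  obtain i where i: "\<bar>f$i\<bar> = 1" using admissible_unit_entry [OF F f] .
  obtain j where j: "\<bar>g$j\<bar> = 1" using admissible_unit_entry [OF F g] .
  have o: "\<bar>x\<bar> = 1 \<Longrightarrow> odd x" for x :: int by presburger
  consider "\<exists>i. odd (f$i - g$i)" | "g = f" | "g = - f"
    using F f g unfolding admissible_def by blast
  then show "s \<inter> t = {} \<or> (\<exists>x. s \<inter> t = {x} \<and> endpoint x s \<and> endpoint x t)"
  proof cases
    case 1
    have "\<forall>i. \<bar>f$i\<bar> \<le> 1" "\<forall>i. \<bar>g$i\<bar> \<le> 1" using F f g by (auto simp: admissible_def)
    then obtain i' j' where "\<bar>f$i' * g$j' - f$j' * g$i'\<bar> = 1"
      using unit_minor [OF _ _ _ _ 1] o [OF i] o [OF j] by blast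
    then show ?thesis unfolding s t by (rule transversal_edges [OF a])
  next
    case 2
    then have "k \<noteq> l" using st s t by auto
    then show ?thesis unfolding s t 2 by (rule parallel_edges [OF a i])
  next
    case 3
    have t': "t = closed_segment (translation a (l - f) p) (translation a (l - f + f) p)"
      by (simp add: t 3 closed_segment_commute)
    then have "k \<noteq> l - f" using st s by auto
    then show ?thesis unfolding s t' by (rule parallel_edges [OF a i])
  qed
qed

lemma admissible_finite:
  assumes "admissible F" shows "finite F"
proof -
  have "F \<subseteq> vec_lambda ` (PiE UNIV (\<lambda>_. {-1..1}))"
  proof
    fix f assume "f \<in> F"
    then have "\<bar>f$i\<bar> \<le> 1" for i using assms by (auto simp: admissible_def)
    then have "vec_nth f \<in> PiE UNIV (\<lambda>_. {-1..1})" by (auto simp: abs_le_iff minus_le_iff)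
    then show "f \<in> vec_lambda ` (PiE UNIV (\<lambda>_. {-1..1}))" by (metis image_eqI vec_nth_inverse)
  qed
  moreover have "finite (PiE (UNIV :: 3 set) (\<lambda>_. {-1..1::int}))" by (intro finite_PiE) auto
  ultimately show ?thesis using finite_surj by blast
qed

lemma proper_lattice_net:
  assumes a: "is_basis a" and F: "admissible F"
  shows "proper_linear_3_periodic_net (lattice_net a p F)"
proof -
  have nz: "f \<noteq> 0" if "f \<in> F" for f using F that by (auto simp: admissible_def)
  obtain f0 where f0: "f0 \<in> F" using F by (auto simp: admissible_def)
  have "countable (snd (lattice_net a p F))"
    unfolding snd_lattice_net by simp
  moreover have "is_segment s" if "s \<in> snd (lattice_net a p F)" for s
    using that nz a unfolding snd_lattice_net_iff is_segment_def
    by (metis translation_eq_iff add_cancel_right_right)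
  moreover have "fst (lattice_net a p F) = {x. \<exists>s\<in>snd (lattice_net a p F). endpoint x s}"
  proof (intro equalityI subsetI)
    fix x assume "x \<in> fst (lattice_net a p F)"
    then obtain k where k: "x = translation a k p" by (auto simp: fst_lattice_net)
    have "endpoint x (closed_segment (translation a k p) (translation a (k + f0) p))"
      using k nz [OF f0] a by simp
    then show "x \<in> {x. \<exists>s\<in>snd (lattice_net a p F). endpoint x s}"
      using lattice_net_edgeI [OF f0] by blast
  next
    fix x assume "x \<in> {x. \<exists>s\<in>snd (lattice_net a p F). endpoint x s}"
    then obtain s where s: "s \<in> snd (lattice_net a p F)" "endpoint x s" by blast
    from s(1) obtain k f where "f \<in> F" "s = closed_segment (translation a k p) (translation a (k + f) p)"
      unfolding snd_lattice_net_iff by blast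
    with s(2) have "f \<in> F" "endpoint x (closed_segment (translation a k p) (translation a (k + f) p))" by simp_all
    then have "x = translation a k p \<or> x = translation a (k + f) p" using nz a by simp
    then show "x \<in> fst (lattice_net a p F)" by (auto simp: fst_lattice_net)
  qed
  moreover have "periodicity_basis (lattice_net a p F) a"
    using periodicity_basis_lattice_net a admissible_finite F by blast
  ultimately show ?thesis
    unfolding proper_linear_3_periodic_net_def using essentially_disjoint_lattice_net [OF a F] by blast
qed

section \<open>Adjacency depth\<close>

lemma card_node_orbits_lattice_net: "card (node_orbits a (lattice_net a p F)) = 1"
  by (simp add: node_orbits_lattice_net)

lemma depth_LQG:
  assumes \<N>: "proper_linear_3_periodic_net \<N>" "periodicity_basis \<N> a"
    and nodes: "fst \<N> = range (\<lambda>k. translation a k p)" and q: "q (fst \<N>) = p"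
  shows "depth (LQG \<N> a q) = Max {nat \<bar>f$i\<bar> | f i. f \<in> label_set a p \<N>}"
proof -
  have "node_orbits a \<N> = {fst \<N>}"
    using eq_lattice_net [OF \<N> nodes] node_orbits_lattice_net by metis
  then have E: "lg_edges (LQG \<N> a q) = {{(fst \<N>, fst \<N>, k - l), (fst \<N>, fst \<N>, - (k - l))} | k l. l - k \<in> label_set a p \<N>}"
    by (simp add: LQG_def q edge_iff_label [OF \<N> nodes])
  have "{nat \<bar>m$i\<bar> | v w m i. \<exists>e\<in>lg_edges (LQG \<N> a q). (v, w, m) \<in> e} = {nat \<bar>f$i\<bar> | f i. f \<in> label_set a p \<N>}"
  proof (intro equalityI subsetI)
    fix x assume "x \<in> {nat \<bar>m$i\<bar> | v w m i. \<exists>e\<in>lg_edges (LQG \<N> a q). (v, w, m) \<in> e}"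
    then obtain v w m i e where x: "x = nat \<bar>m$i\<bar>" and e: "e \<in> lg_edges (LQG \<N> a q)" "(v, w, m) \<in> e" by blast
    then obtain k l where kl: "l - k \<in> label_set a p \<N>" and "e = {(fst \<N>, fst \<N>, k - l), (fst \<N>, fst \<N>, - (k - l))}"
      unfolding E by blast
    then have "m = k - l \<or> m = - (k - l)" using e(2) by auto
    then have "x = nat \<bar>(l - k)$i\<bar>" unfolding x by (auto simp: abs_minus_commute)
    then show "x \<in> {nat \<bar>f$i\<bar> | f i. f \<in> label_set a p \<N>}" using kl by blast
  next
    fix x assume "x \<in> {nat \<bar>f$i\<bar> | f i. f \<in> label_set a p \<N>}"
    then obtain f i where x: "x = nat \<bar>f$i\<bar>" and f: "f \<in> label_set a p \<N>" by blast
    have "{(fst \<N>, fst \<N>, 0 - f), (fst \<N>, fst \<N>, - (0 - f))} \<in> lg_edges (LQG \<N> a q)"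
      unfolding E using f by (intro CollectI exI [of _ 0] exI [of _ f]) simp
    then have "\<exists>e\<in>lg_edges (LQG \<N> a q). (fst \<N>, fst \<N>, f) \<in> e" by (rule bexI [rotated]) simp
    then show "x \<in> {nat \<bar>m$i\<bar> | v w m i. \<exists>e\<in>lg_edges (LQG \<N> a q). (v, w, m) \<in> e}"
      unfolding x by blast
  qed
  then show ?thesis unfolding depth_def by simp
qed

lemma finite_abs_entries:
  assumes "finite (F :: label set)" shows "finite {nat \<bar>f$i\<bar> | f i. f \<in> F}"
proof -
  have "{nat \<bar>f$i\<bar> | f i. f \<in> F} = (\<lambda>(f, i). nat \<bar>f$i\<bar>) ` (F \<times> UNIV)" by auto
  then show ?thesis using assms by simp
qed

text \<open>If \<open>f - g = 2k\<close>, the edge with label \<open>f\<close> at the origin and the edge with label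
  \<open>g\<close> at \<open>k\<close> have the same midpoint.\<close>

lemma uncrossed_labels:
  assumes a: "is_basis a" and dis: "essentially_disjoint (snd (lattice_net a p F))"
    and f: "f \<in> F" "f \<noteq> 0" and g: "g \<in> F" "g \<noteq> 0" and ev: "\<forall>i. even (f$i - g$i)"
  shows "g = f \<or> g = - f"
proof -
  define k where "k = (\<chi> i. (f$i - g$i) div 2)"
  have k: "f = k + (k + g)" using ev by (simp add: k_def vec_eq_iff)
  define s where "s = closed_segment (translation a 0 p) (translation a (0 + f) p)"
  define t where "t = closed_segment (translation a k p) (translation a (k + g) p)"
  define x where "x = p + frame a (real_vec 0 + (1/2) *\<^sub>R real_vec f)"
  have "s \<in> snd (lattice_net a p F)" "t \<in> snd (lattice_net a p F)"
    unfolding s_def t_def using f g by (simp_all only: lattice_net_edgeI)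
  then have st: "s = t \<or> s \<inter> t = {} \<or> (\<exists>x. s \<inter> t = {x} \<and> endpoint x s)"
    using dis unfolding essentially_disjoint_def by blast
  have xs: "x \<in> s" unfolding s_def point_of_edge_iff x_def by (rule exI [of _ "1/2"]) simp
  have half: "(1/2) *\<^sub>R real_vec f = real_vec k + (1/2) *\<^sub>R real_vec g"
    by (subst k) (simp add: vec_eq_iff)
  then have xt: "x \<in> t" unfolding t_def point_of_edge_iff x_def
    by (intro exI [of _ "1/2"]) simp
  have not_end: "\<not> endpoint x s"
  proof
    assume e: "endpoint x s"
    have ne: "translation a 0 p \<noteq> translation a (0 + f) p"
      using f(2) translation_eq_iff [OF a, where k = 0 and l = "0 + f" and x = p] by (simp del: translation_0)
    have "x = translation a 0 p \<or> x = translation a (0 + f) p"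
      using e unfolding s_def by (rule endpoint_iff [OF ne, THEN iffD1])
    then have "x = p + frame a 0 \<or> x = p + frame a (real_vec f)"
      by (simp add: translation_frame)
    then have "frame a ((1/2) *\<^sub>R real_vec f) = frame a 0 \<or> frame a ((1/2) *\<^sub>R real_vec f) = frame a (real_vec f)"
      unfolding x_def by simp
    then have "(1/2) *\<^sub>R real_vec f = 0 \<or> (1/2) *\<^sub>R real_vec f = real_vec f"
      using frame_inj [OF a] by (simp add: inj_eq)
    then show False using f(2) by (auto simp: vec_eq_iff)
  qed
  have "s = t"
  proof (rule ccontr)
    assume "s \<noteq> t"
    then obtain y where y: "s \<inter> t = {y}" "endpoint y s" using st xs xt by blast
    have "x \<in> s \<inter> t" using xs xt by (rule IntI)
    then have "x = y" unfolding y(1) by (rule singletonD)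
    then show False using y(2) not_end by simp
  qed
  then have "{translation a 0 p, translation a (0 + f) p} = {translation a k p, translation a (k + g) p}"
    unfolding s_def t_def closed_segment_eq .
  then have "0 = k \<and> 0 + f = k + g \<or> 0 = k + g \<and> 0 + f = k"
    unfolding doubleton_eq_iff translation_eq_iff [OF a] .
  then show ?thesis by (auto simp: eq_neg_iff_add_eq_0 add.commute)
qed

text \<open>The minimal depth is attained at some primitive basis, and the net is described in that basis. The
  finiteness of the label set is what makes the maximum in the depth a bound for the labels.\<close>

lemma depth_1_labels:
  assumes \<N>: "proper_linear_3_periodic_net \<N>" "adjacency_depth \<N> = 1" "single_vertex_quotient_graph \<N>"
  obtains a p F where "is_basis a" "\<N> = lattice_net a p F" "admissible F" "\<And>f. f \<in> F \<Longrightarrow> - f \<in> F"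
proof -
  have "\<exists>d a q. primitive_basis \<N> a \<and> representatives \<N> a q \<and> d = depth (LQG \<N> a q)"
    using \<N>(3) unfolding single_vertex_quotient_graph_def is_quotient_graph_def by blast
  from LeastI_ex [OF this] obtain a q where a: "primitive_basis \<N> a" "representatives \<N> a q" "1 = depth (LQG \<N> a q)"
    using \<N>(2) unfolding adjacency_depth_def by auto
  have per: "periodicity_basis \<N> a" using a by (simp add: primitive_basis_def)
  then have basis: "is_basis a" by (simp add: periodicity_basis_def)
  define p where "p = q (fst \<N>)"
  have "fst \<N> \<noteq> {}"
  proof
    assume "fst \<N> = {}"
    then obtain b where "primitive_basis \<N> b" "card (node_orbits b \<N>) = 1"
      using \<N>(3) unfolding single_vertex_quotient_graph_def is_quotient_graph_def
      by (auto simp only: underlying_multigraph_def LQG_def multigraph.select_convs labelled_graph.select_convs)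
    with \<open>fst \<N> = {}\<close> show False by (simp add: node_orbits_def)
  qed
  then obtain x where x: "x \<in> fst \<N>" by blast
  have nx: "fst \<N> = range (\<lambda>k. translation a k x)" using single_vertex_nodes [OF \<N>(3) a(1) x] .
  have "node_orbits a \<N> = {fst \<N>}"
    using eq_lattice_net [OF \<N>(1) per nx] node_orbits_lattice_net by metis
  then have "p \<in> fst \<N>" using a(2) by (simp add: representatives_def p_def)
  then have nodes: "fst \<N> = range (\<lambda>k. translation a k p)" by (rule single_vertex_nodes [OF \<N>(3) a(1)])
  let ?F = "label_set a p \<N>"
  have fin: "finite {nat \<bar>f$i\<bar> | f i. f \<in> ?F}"
    by (rule finite_abs_entries) (rule finite_label_set [OF \<N>(1) per nodes])
  have "1 = Max {nat \<bar>f$i\<bar> | f i. f \<in> ?F}"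
    using a(3) depth_LQG [OF \<N>(1) per nodes] by (simp add: p_def)
  then have cube: "\<bar>f$i\<bar> \<le> 1" if "f \<in> ?F" for f i
    using Max_ge [OF fin, of "nat \<bar>f$i\<bar>"] that by fastforce
  have eq: "\<N> = lattice_net a p ?F" by (rule eq_lattice_net [OF \<N>(1) per nodes])
  have z: "0 \<notin> ?F" by (rule zero_not_label [OF \<N>(1) per nodes])
  have "essentially_disjoint (snd (lattice_net a p ?F))"
    using \<N>(1) eq by (simp add: proper_linear_3_periodic_net_def)
  then have "g = f \<or> g = - f" if "f \<in> ?F" "g \<in> ?F" "\<forall>i. even (f$i - g$i)" for f g
    using uncrossed_labels [OF basis _ that(1) _ that(2) _ that(3)] that z by metis
  then have "admissible ?F"
    unfolding admissible_def using cube z label_set_nonempty [OF \<N>(1) per nodes] by blast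
  then show thesis
    using that basis eq label_set_minus [OF \<N>(1) per nodes] by blast
qed

lemma single_vertex_lattice_net:
  assumes "is_basis a" "finite F" shows "single_vertex_quotient_graph (lattice_net a p F)"
proof -
  let ?N = "lattice_net a p F"
  have "p \<in> fst ?N" unfolding fst_lattice_net by (metis rangeI translation_0)
  then have "representatives ?N a (\<lambda>_. p)"
    by (simp add: representatives_def node_orbits_lattice_net)
  then have "is_quotient_graph ?N (underlying_multigraph (LQG ?N a (\<lambda>_. p)))"
    unfolding is_quotient_graph_def using primitive_basis_lattice_net [OF assms] by blast
  moreover have "card (mg_verts (underlying_multigraph (LQG ?N a (\<lambda>_. p)))) = 1"
    by (simp only: underlying_multigraph_def LQG_def multigraph.select_convs labelled_graph.select_convs card_node_orbits_lattice_net)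
  ultimately show ?thesis unfolding single_vertex_quotient_graph_def by blast
qed

lemma label_set_lattice_net:
  assumes "is_basis a" shows "label_set a p (lattice_net a p F) = sym_closure F"
  using lattice_net_edge_iff [OF assms, of 0 p _ F] by (auto simp: label_set_def)

lemma Max_abs_entries_pos:
  assumes "finite (F :: label set)" "F \<noteq> {}" "0 \<notin> F"
  shows "1 \<le> Max {nat \<bar>f$i\<bar> | f i. f \<in> F}"
proof -
  obtain f where f: "f \<in> F" "f \<noteq> 0" using assms by auto
  then obtain i where "f$i \<noteq> 0" by (auto simp: vec_eq_iff)
  then have "1 \<le> nat \<bar>f$i\<bar>" by linarith
  also have "nat \<bar>f$i\<bar> \<le> Max {nat \<bar>f$i\<bar> | f i. f \<in> F}"
    using f by (intro Max_ge finite_abs_entries assms) blast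
  finally show ?thesis .
qed

text \<open>Depth 0 is impossible in every primitive basis, since the labels are nonzero, so it suffices that the
  given basis has depth 1.\<close>

lemma adjacency_depth_lattice_net:
  assumes a: "is_basis a" and F: "admissible F"
  shows "adjacency_depth (lattice_net a p F) = 1"
proof -
  let ?N = "lattice_net a p F"
  have fin: "finite F" using F by (rule admissible_finite)
  have proper: "proper_linear_3_periodic_net ?N" by (rule proper_lattice_net [OF a F])
  have single: "single_vertex_quotient_graph ?N" by (rule single_vertex_lattice_net [OF a fin])
  have pos: "1 \<le> depth (LQG ?N b q)" if b: "primitive_basis ?N b" and q: "representatives ?N b q" for b q
  proof -
    have per: "periodicity_basis ?N b" using b by (simp add: primitive_basis_def)
    have "p \<in> fst ?N" unfolding fst_lattice_net by (metis rangeI translation_0)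
    then have n: "fst ?N = range (\<lambda>k. translation b k p)" by (rule single_vertex_nodes [OF single b])
    have "node_orbits b ?N = {fst ?N}"
      using eq_lattice_net [OF proper per n] node_orbits_lattice_net by metis
    then have "q (fst ?N) \<in> fst ?N" using q by (simp add: representatives_def)
    then have nq: "fst ?N = range (\<lambda>k. translation b k (q (fst ?N)))" by (rule single_vertex_nodes [OF single b])
    show ?thesis
      unfolding depth_LQG [where q = q, OF proper per nq refl]
      using finite_label_set [OF proper per nq] label_set_nonempty [OF proper per nq] zero_not_label [OF proper per nq]
      by (rule Max_abs_entries_pos)
  qed
  have "p \<in> fst ?N" unfolding fst_lattice_net by (metis rangeI translation_0)
  then have rep: "representatives ?N a (\<lambda>_. p)" by (simp add: representatives_def node_orbits_lattice_net)
  have prim: "primitive_basis ?N a" by (rule primitive_basis_lattice_net [OF a fin])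
  have "depth (LQG ?N a (\<lambda>_. p)) = Max {nat \<bar>f$i\<bar> | f i. f \<in> sym_closure F}"
    using depth_LQG [where q = "\<lambda>_. p", OF proper periodicity_basis_lattice_net [OF a fin] fst_lattice_net refl]
    by (simp add: label_set_lattice_net [OF a])
  also have "\<dots> \<le> 1"
  proof (rule Max.boundedI)
    show "finite {nat \<bar>f$i\<bar> | f i. f \<in> sym_closure F}"
      using fin by (intro finite_abs_entries) (simp add: sym_closure_def)
    show "{nat \<bar>f$i\<bar> | f i. f \<in> sym_closure F} \<noteq> {}"
    proof -
      obtain f where "f \<in> F" using F by (auto simp: admissible_def)
      then have "nat \<bar>f$1\<bar> \<in> {nat \<bar>f$i\<bar> | f i. f \<in> sym_closure F}" unfolding sym_closure_def by blast
      then show ?thesis by blast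
    qed
    fix x assume "x \<in> {nat \<bar>f$i\<bar> | f i. f \<in> sym_closure F}"
    then obtain f i where "x = nat \<bar>f$i\<bar>" "f \<in> F \<or> - f \<in> F" by (auto simp: sym_closure_iff)
    moreover have "\<bar>g$i\<bar> \<le> 1" if "g \<in> F" for g using F that by (auto simp: admissible_def)
    ultimately show "x \<le> 1" by fastforce
  qed
  finally have "depth (LQG ?N a (\<lambda>_. p)) = 1" using pos [OF prim rep] by simp
  then show ?thesis
    unfolding adjacency_depth_def
  proof (intro Least_equality)
    assume "depth (LQG ?N a (\<lambda>_. p)) = 1"
    then show "\<exists>b q. primitive_basis ?N b \<and> representatives ?N b q \<and> 1 = depth (LQG ?N b q)"
      using prim rep by metis
  next
    fix d assume "\<exists>b q. primitive_basis ?N b \<and> representatives ?N b q \<and> d = depth (LQG ?N b q)"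
    then show "1 \<le> d" using pos by blast
  qed
qed

section \<open>Connectedness\<close>

lemma adjacency_lattice_net_iff:
  assumes "is_basis a"
  shows "(x, y) \<in> adjacency (lattice_net a p F)
    \<longleftrightarrow> (\<exists>k f. f \<in> sym_closure F \<and> x = translation a k p \<and> y = translation a (k + f) p)"
proof
  assume "(x, y) \<in> adjacency (lattice_net a p F)"
  then obtain k l where kl: "x = translation a k p" "y = translation a l p"
    and e: "closed_segment (translation a k p) (translation a l p) \<in> snd (lattice_net a p F)"
    by (auto simp: adjacency_def fst_lattice_net)
  then have "l - k \<in> sym_closure F" using lattice_net_edge_iff assms by blast
  moreover have "y = translation a (k + (l - k)) p" using kl by simp
  ultimately show "\<exists>k f. f \<in> sym_closure F \<and> x = translation a k p \<and> y = translation a (k + f) p"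
    using kl by blast
next
  assume "\<exists>k f. f \<in> sym_closure F \<and> x = translation a k p \<and> y = translation a (k + f) p"
  then show "(x, y) \<in> adjacency (lattice_net a p F)"
    using assms by (auto simp: adjacency_def fst_lattice_net lattice_net_edge_iff)
qed

lemma reachable_multiple:
  assumes a: "is_basis a" and f: "f \<in> F"
  shows "(translation a k p, translation a (k + n *s f) p) \<in> (adjacency (lattice_net a p F))\<^sup>*"
proof -
  have nat: "(translation a k p, translation a (k + int m *s g) p) \<in> (adjacency (lattice_net a p F))\<^sup>*"
    if g: "g \<in> sym_closure F" for m g
  proof (induction m)
    case 0 then show ?case by simp
  next
    case (Suc m)
    have "k + int (Suc m) *s g = (k + int m *s g) + g" by (simp add: vec_eq_iff algebra_simps)
    then have "(translation a (k + int m *s g) p, translation a (k + int (Suc m) *s g) p) \<in> adjacency (lattice_net a p F)"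
      using adjacency_lattice_net_iff [OF a] g by metis
    with Suc show ?case by (rule rtrancl_into_rtrancl)
  qed
  have f': "f \<in> sym_closure F" "- f \<in> sym_closure F" using f by (auto simp: sym_closure_iff)
  show ?thesis
  proof (cases "0 \<le> n")
    case True
    then show ?thesis using nat [OF f'(1), of "nat n"] by simp
  next
    case False
    then have "int (nat (- n)) *s (- f) = n *s f" by (simp add: vec_eq_iff)
    then show ?thesis using nat [OF f'(2), of "nat (- n)"] by metis
  qed
qed

text \<open>Such labels generate the lattice, so that every node is reached by walking along multiples of the
  three labels in turn.\<close>

lemma unimodular_labels_connected:
  assumes a: "is_basis a" and F: "f \<in> F" "g \<in> F" "h \<in> F" and det: "\<bar>det3 f g h\<bar> = 1"
  shows "\<not> disconnected_net (lattice_net a p F)"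
proof -
  let ?R = "(adjacency (lattice_net a p F))\<^sup>*"
  have reach: "(translation a k p, translation a l p) \<in> ?R" for k l
  proof -
    have "\<bar>det (vector [f, g, h] :: int^3^3)\<bar> = 1" using det by (simp add: det3_def)
    then obtain c where c: "l - k = c v* (vector [f, g, h] :: int^3^3)" by (rule unimodular_surj)
    then have "l = k + c$1 *s f + c$2 *s g + c$3 *s h"
      by (simp add: vector_matrix_3 algebra_simps)
    then show ?thesis
      using reachable_multiple [OF a F(1), of k p "c$1"] reachable_multiple [OF a F(2), of "k + c$1 *s f" p "c$2"]
        reachable_multiple [OF a F(3), of "k + c$1 *s f + c$2 *s g" p "c$3"] by (metis rtrancl_trans)
  qed
  have sub: "y \<in> fst (lattice_net a p F)" if "(x, y) \<in> ?R" "x \<in> fst (lattice_net a p F)" for x y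
    using that by (induction rule: rtrancl_induct) (auto simp: adjacency_def)
  have "?R `` {x} = fst (lattice_net a p F)" if x: "x \<in> fst (lattice_net a p F)" for x
  proof (intro equalityI subsetI)
    fix y assume "y \<in> ?R `` {x}" then show "y \<in> fst (lattice_net a p F)" using sub x by blast
  next
    fix y assume "y \<in> fst (lattice_net a p F)"
    with x obtain k l where "x = translation a k p" "y = translation a l p"
      unfolding fst_lattice_net by blast
    then show "y \<in> ?R `` {x}" using reach by blast
  qed
  then have "C = fst (lattice_net a p F)" if "C \<in> net_components (lattice_net a p F)" for C
    using that unfolding net_components_def quotient_def by blast
  then show ?thesis unfolding disconnected_net_def by blast
qed

text \<open>If an integral linear functional vanishes modulo \<open>m\<close> on the labels, its residue is the same for
  all nodes of a component. The case \<open>m = 0\<close> covers labels that lie in a plane.\<close>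

lemma disconnected_lattice_net:
  fixes m :: int and c :: label
  assumes a: "is_basis a" and F: "\<And>f. f \<in> F \<Longrightarrow> m dvd (\<Sum>i\<in>UNIV. c$i * f$i)"
    and k: "\<not> m dvd (\<Sum>i\<in>UNIV. c$i * k$i)"
  shows "disconnected_net (lattice_net a p F)"
proof -
  let ?R = "(adjacency (lattice_net a p F))\<^sup>*"
  let ?\<phi> = "\<lambda>k :: label. \<Sum>i\<in>UNIV. c$i * k$i"
  have add: "?\<phi> (k + l) = ?\<phi> k + ?\<phi> l" for k l by (simp add: algebra_simps sum.distrib)
  have neg: "?\<phi> (- k) = - ?\<phi> k" for k by (simp add: sum_negf)
  have F': "m dvd ?\<phi> f" if "f \<in> sym_closure F" for f
  proof -
    have "m dvd ?\<phi> f \<or> m dvd ?\<phi> (- f)" using F that unfolding sym_closure_iff by blast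
    then show ?thesis by (metis neg dvd_minus_iff)
  qed
  have inv: "\<exists>l. y = translation a l p \<and> m dvd ?\<phi> l" if "(translation a 0 p, y) \<in> ?R" for y
    using that
  proof (induction rule: rtrancl_induct)
    case base
    have "m dvd ?\<phi> 0" by simp
    then show ?case by blast
  next
    case (step y z)
    then obtain l where l: "y = translation a l p" "m dvd ?\<phi> l" by blast
    obtain j f where "f \<in> sym_closure F" "y = translation a j p" "z = translation a (j + f) p"
      using step(2) unfolding adjacency_lattice_net_iff [OF a] by blast
    then have "z = translation a (l + f) p" "m dvd ?\<phi> (l + f)"
      using l a F' by (auto simp: add simp del: vector_add_component)
    then show ?case by blast
  qed
  let ?x = "translation a 0 p" and ?y = "translation a k p"
  have nodes: "?x \<in> fst (lattice_net a p F)" "?y \<in> fst (lattice_net a p F)"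
    unfolding fst_lattice_net by blast+
  have "(?x, ?y) \<notin> ?R"
  proof
    assume "(?x, ?y) \<in> ?R"
    then obtain l where "?y = translation a l p" "m dvd ?\<phi> l" using inv by blast
    then show False using k a by simp
  qed
  moreover have "(?y, ?y) \<in> ?R" by simp
  ultimately have ne: "?R `` {?x} \<noteq> ?R `` {?y}" by blast
  have C: "?R `` {?x} \<in> net_components (lattice_net a p F)" "?R `` {?y} \<in> net_components (lattice_net a p F)"
    unfolding net_components_def by (rule quotientI, rule nodes)+
  show ?thesis unfolding disconnected_net_def by (rule bexI [OF _ C(1)], rule bexI [OF _ C(2)], rule ne)
qed

section \<open>Affine equivalence\<close>

text \<open>An integral change of basis of determinant \<open>\<plusminus> 1\<close> does not change the lattice, so it can be
  absorbed into the periodicity basis. This makes nets with equivalent label sets affinely equivalent.\<close>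

lemma lattice_net_basis_change:
  fixes B :: "int^3^3"
  assumes a: "is_basis a" and B: "\<bar>det B\<bar> = 1"
  defines "b \<equiv> \<lambda>i. frame a (real_vec (B$i))"
  shows "is_basis b" "lattice_net a p ((\<lambda>c. c v* B) ` C) = lattice_net b p C"
proof -
  interpret A: linear "frame a" by (rule linear_frame)
  have B3: "real_vec (c v* B) = (\<Sum>i\<in>UNIV. of_int (c$i) *\<^sub>R real_vec (B$i))" for c
    by (simp add: vec_eq_iff vector_matrix_mult_def)
  have tr: "translation b c x = translation a (c v* B) x" for c x
    by (simp add: translation_frame B3 A.sum A.scale) (simp add: frame_def b_def)
  have lin: "(c + d) v* B = c v* B + d v* B" for c d by (rule vector_matrix_left_distrib)
  have surj: "\<exists>c. k = c v* B" for k using unimodular_surj [OF B] by metis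
  have "range (\<lambda>k. translation b k p) = range (\<lambda>k. translation a k p)"
    unfolding tr
  proof (intro equalityI subsetI)
    fix x assume "x \<in> range (\<lambda>k. translation a k p)"
    then obtain k where k: "x = translation a k p" by blast
    obtain c where "k = c v* B" using surj by blast
    then show "x \<in> range (\<lambda>k. translation a (k v* B) p)" unfolding k by blast
  qed blast
  moreover have "snd (lattice_net a p ((\<lambda>c. c v* B) ` C)) = snd (lattice_net b p C)"
  proof (intro equalityI subsetI)
    fix s assume "s \<in> snd (lattice_net a p ((\<lambda>c. c v* B) ` C))"
    then obtain k c where c: "c \<in> C" and s: "s = closed_segment (translation a k p) (translation a (k + c v* B) p)"
      unfolding snd_lattice_net_iff by blast
    obtain j where "k = j v* B" using surj by blast
    then have "s = closed_segment (translation b j p) (translation b (j + c) p)" by (simp add: s tr lin)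
    with c show "s \<in> snd (lattice_net b p C)" using lattice_net_edgeI by blast
  next
    fix s assume "s \<in> snd (lattice_net b p C)"
    then obtain j c where c: "c \<in> C" and s: "s = closed_segment (translation b j p) (translation b (j + c) p)"
      unfolding snd_lattice_net_iff by blast
    then have "s = closed_segment (translation a (j v* B) p) (translation a (j v* B + c v* B) p)" by (simp add: tr lin)
    then show "s \<in> snd (lattice_net a p ((\<lambda>c. c v* B) ` C))" using lattice_net_edgeI [OF imageI [OF c]] by simp
  qed
  ultimately show "lattice_net a p ((\<lambda>c. c v* B) ` C) = lattice_net b p C"
    by (intro prod_eqI) (simp_all add: fst_lattice_net)
  have ab: "a i \<in> span (range b)" for i
  proof -
    obtain c where c: "axis i 1 = c v* B" using surj by blast
    have "a i = frame a (real_vec (axis i 1))"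
      by (simp add: frame_def axis_def if_distrib [of real_of_int] if_distrib [of "\<lambda>x. x *\<^sub>R _"] cong: if_cong)
    also have "\<dots> = (\<Sum>i\<in>UNIV. of_int (c$i) *\<^sub>R b i)"
      by (simp add: c B3 A.sum A.scale b_def)
    finally show ?thesis by (simp add: span_sum span_scale span_base)
  qed
  have "span (range a) \<subseteq> span (range b)"
    using ab by (intro span_minimal) auto
  then have "span (range b) = UNIV" using a by (auto simp: is_basis_def)
  then show "is_basis b" by (intro is_basis_if_spanning) simp
qed

lemma map_net_map_net: "map_net f (map_net g \<N>) = map_net (f \<circ> g) \<N>"
  by (simp add: map_net_def image_image image_comp [symmetric] comp_def)

lemma affine_equivalence_iff:
  "(\<M>, \<N>) \<in> affine_equivalence \<longleftrightarrow>
     proper_linear_3_periodic_net \<M> \<and> proper_linear_3_periodic_net \<N> \<and>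
     (\<exists>w (X :: real^3^3). invertible X \<and> \<N> = map_net (\<lambda>x. w + X *v x) \<M>)"
proof -
  have "(\<exists>u v (X :: real^3^3). invertible X \<and> map_net ((*v) X) (map_net ((+) u) \<M>) = map_net ((+) v) \<N>)
    \<longleftrightarrow> (\<exists>w (X :: real^3^3). invertible X \<and> \<N> = map_net (\<lambda>x. w + X *v x) \<M>)" (is "?L \<longleftrightarrow> ?R")
  proof
    assume ?L
    then obtain u v and X :: "real^3^3" where X: "invertible X"
      and e: "map_net ((*v) X) (map_net ((+) u) \<M>) = map_net ((+) v) \<N>" by blast
    have "\<N> = map_net ((+) (- v)) (map_net ((+) v) \<N>)"
      by (simp add: map_net_map_net comp_def) (simp add: map_net_def)
    also have "\<dots> = map_net (\<lambda>x. (X *v u - v) + X *v x) \<M>"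
      unfolding e [symmetric] map_net_map_net by (simp add: comp_def matrix_vector_right_distrib algebra_simps)
    finally show ?R using X by blast
  next
    assume ?R
    then obtain w and X :: "real^3^3" where X: "invertible X" and e: "\<N> = map_net (\<lambda>x. w + X *v x) \<M>" by blast
    have "map_net ((*v) X) (map_net ((+) 0) \<M>) = map_net ((+) (- w)) \<N>"
      unfolding e map_net_map_net by (simp add: comp_def)
    then show ?L using X by blast
  qed
  then show ?thesis by (simp add: affine_equivalence_def)
qed

lemma affine_equivalence_sym: "sym affine_equivalence"
proof (rule symI)
  fix \<M> \<N> assume "(\<M>, \<N>) \<in> affine_equivalence"
  then obtain w and X :: "real^3^3" where p: "proper_linear_3_periodic_net \<M>" "proper_linear_3_periodic_net \<N>"
    and X: "invertible X" and e: "\<N> = map_net (\<lambda>x. w + X *v x) \<M>"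
    unfolding affine_equivalence_iff by blast
  obtain Y where Y: "X ** Y = mat 1" "Y ** X = mat 1" using X unfolding invertible_def by blast
  have "map_net (\<lambda>x. - (Y *v w) + Y *v x) \<N> = map_net (\<lambda>x. x) \<M>"
    unfolding e map_net_map_net
    by (simp add: comp_def matrix_vector_right_distrib matrix_vector_mul_assoc Y)
  then have "\<M> = map_net (\<lambda>x. - (Y *v w) + Y *v x) \<N>" by (simp add: map_net_def)
  moreover have "invertible Y" using Y unfolding invertible_def by blast
  ultimately show "(\<N>, \<M>) \<in> affine_equivalence" unfolding affine_equivalence_iff using p by blast
qed

lemma affine_equivalence_trans: "trans affine_equivalence"
proof (rule transI)
  fix \<M> \<N> \<P> assume "(\<M>, \<N>) \<in> affine_equivalence" "(\<N>, \<P>) \<in> affine_equivalence"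
  then obtain w z and X Y :: "real^3^3" where p: "proper_linear_3_periodic_net \<M>" "proper_linear_3_periodic_net \<P>"
    and X: "invertible X" "invertible Y" and e: "\<N> = map_net (\<lambda>x. w + X *v x) \<M>" "\<P> = map_net (\<lambda>x. z + Y *v x) \<N>"
    unfolding affine_equivalence_iff by blast
  have "\<P> = map_net (\<lambda>x. (z + Y *v w) + (Y ** X) *v x) \<M>"
    unfolding e map_net_map_net
    by (simp add: comp_def matrix_vector_right_distrib matrix_vector_mul_assoc add.assoc)
  moreover have "invertible (Y ** X)" using X by (simp add: invertible_mult)
  ultimately show "(\<M>, \<P>) \<in> affine_equivalence" unfolding affine_equivalence_iff using p by blast
qed

lemma affine_segment:
  "(\<lambda>x. w + X *v x) ` closed_segment p q = closed_segment (w + X *v p) (w + X *v (q :: pt))" for X :: "real^3^3"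
proof -
  have "(\<lambda>x. w + X *v x) ` closed_segment p q = (+) w ` ((*v) X ` closed_segment p q)" by (simp add: image_image)
  also have "\<dots> = closed_segment (w + X *v p) (w + X *v q)"
    by (simp add: closed_segment_linear_image [symmetric] closed_segment_translation)
  finally show ?thesis .
qed

lemma lattice_nets_affinely_equivalent:
  assumes a: "is_basis a" and b: "is_basis b"
    and p: "proper_linear_3_periodic_net (lattice_net a p F)" "proper_linear_3_periodic_net (lattice_net b q F)"
  shows "(lattice_net a p F, lattice_net b q F) \<in> affine_equivalence"
proof -
  obtain h where h: "linear h" "h \<circ> frame a = id" "frame a \<circ> h = id"
    using linear_injective_isomorphism [OF linear_frame frame_inj [OF a]] by (metis comp_apply eq_id_iff ext)
  define X where "X = matrix (frame b \<circ> h)"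
  have lin: "linear (frame b \<circ> h)" using h linear_frame linear_compose by blast
  have X: "X *v x = frame b (h x)" for x
    using fun_cong [OF matrix_vector_mul(2) [OF lin]] by (simp add: X_def)
  have "inj h" using h(3) by (metis inj_on_id inj_on_imageI2)
  then have "inj (frame b \<circ> h)" using frame_inj [OF b] by (rule inj_compose [rotated])
  moreover have "(*v) X = frame b \<circ> h" by (rule ext) (simp add: X)
  ultimately have "inj ((*v) X)" by simp
  then have inv: "invertible X"
    using matrix_left_invertible_injective invertible_left_inverse by blast
  have Xa: "X *v frame a v = frame b v" for v using h(2) by (simp add: X fun_eq_iff)
  define w where "w = q - X *v p"
  have tr: "w + X *v translation a k p = translation b k q" for k
    by (simp add: w_def translation_frame matrix_vector_right_distrib Xa)
  have "lattice_net b q F = map_net (\<lambda>x. w + X *v x) (lattice_net a p F)"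
    unfolding map_net_def
    by (intro prod_eqI) (simp_all add: fst_lattice_net snd_lattice_net image_image case_prod_unfold affine_segment tr)
  then show ?thesis unfolding affine_equivalence_iff using p inv by blast
qed

text \<open>An affine map between two lattice nets maps nodes to nodes. Its linear part therefore induces an
  automorphism of the integer lattice, and this automorphism carries the labels of edges to labels of edges.
  All invariants used below come from this.\<close>

lemma affine_equivalence_labels:
  assumes eq: "(lattice_net a p F, lattice_net b q G) \<in> affine_equivalence"
    and a: "is_basis a" and b: "is_basis b"
  obtains \<theta> where "bij \<theta>" "\<And>x y. \<theta> (x + y) = \<theta> x + \<theta> y" "\<theta> ` sym_closure F = sym_closure G"
proof -
  obtain w and X :: "real^3^3" where X: "invertible X"
    and e: "lattice_net b q G = map_net (\<lambda>x. w + X *v x) (lattice_net a p F)"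
    using eq unfolding affine_equivalence_iff by blast
  let ?\<phi> = "\<lambda>x. w + X *v x"
  have inj: "inj ?\<phi>"
  proof (rule injI)
    obtain Y where "Y ** X = mat 1" using X unfolding invertible_def by blast
    then show "x = y" if "w + X *v x = w + X *v y" for x y
      using that by (metis add_left_cancel matrix_vector_mul_assoc matrix_vector_mul_lid)
  qed
  have nodes: "range (\<lambda>k. translation b k q) = range (\<lambda>k. ?\<phi> (translation a k p))"
    using arg_cong [OF e, of fst] by (simp add: map_net_def fst_lattice_net image_image)
  then have "\<exists>l. ?\<phi> (translation a k p) = translation b l q" for k by blast
  then obtain \<psi> where \<psi>: "\<And>k. ?\<phi> (translation a k p) = translation b (\<psi> k) q" by metis
  define \<theta> where "\<theta> k = \<psi> k - \<psi> 0" for k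
  have lin: "frame b (real_vec (\<theta> k)) = X *v frame a (real_vec k)" for k
  proof -
    have "frame b (real_vec (\<theta> k)) = translation b (\<psi> k) q - translation b (\<psi> 0) q"
      by (simp add: \<theta>_def translation_frame linear_diff [OF linear_frame])
    also have "\<dots> = X *v frame a (real_vec k)"
      unfolding \<psi> [symmetric] by (simp add: translation_frame matrix_vector_right_distrib linear_0 [OF linear_frame])
    finally show ?thesis .
  qed
  have fb: "frame b (real_vec x) = frame b (real_vec y) \<longleftrightarrow> x = y" for x y
    using frame_inj [OF b] by (simp add: inj_eq)
  have add: "\<theta> (x + y) = \<theta> x + \<theta> y" for x y
  proof -
    have "frame b (real_vec (\<theta> (x + y))) = frame b (real_vec (\<theta> x + \<theta> y))"
      unfolding lin real_vec_simps linear_add [OF linear_frame] matrix_vector_right_distrib ..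
    then show ?thesis unfolding fb .
  qed
  have \<psi>\<theta>: "\<psi> k = \<theta> k + \<psi> 0" for k by (simp add: \<theta>_def)
  have "inj \<psi>"
  proof (rule injI)
    fix k l assume "\<psi> k = \<psi> l"
    then have "?\<phi> (translation a k p) = ?\<phi> (translation a l p)" unfolding \<psi> by simp
    then have "translation a k p = translation a l p" by (rule injD [OF inj])
    then show "k = l" using a by simp
  qed
  then have "inj \<theta>" by (simp add: \<theta>_def inj_def)
  moreover have "surj \<psi>"
  proof -
    have "\<exists>k. y = \<psi> k" for y
    proof -
      have "translation b y q \<in> range (\<lambda>k. ?\<phi> (translation a k p))" unfolding nodes [symmetric] by blast
      then show ?thesis unfolding \<psi> using b by auto
    qed
    then show ?thesis by (auto simp: surj_def)
  qed
  then have "surj \<theta>"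
    unfolding surj_def \<theta>_def by (metis add_diff_cancel)
  ultimately have bij: "bij \<theta>" by (simp add: bij_def)
  have edge: "f \<in> sym_closure F \<longleftrightarrow> \<theta> f \<in> sym_closure G" for f
  proof -
    have "f \<in> sym_closure F \<longleftrightarrow> closed_segment (translation a 0 p) (translation a f p) \<in> snd (lattice_net a p F)"
      unfolding lattice_net_edge_iff [OF a] by simp
    also have "\<dots> \<longleftrightarrow> ?\<phi> ` closed_segment (translation a 0 p) (translation a f p) \<in> (`) ?\<phi> ` snd (lattice_net a p F)"
    proof -
      have "inj ((`) ?\<phi>)" by (rule injI) (simp add: inj_image_eq_iff [OF inj])
      then show ?thesis by (simp only: inj_image_mem_iff)
    qed
    also have "(`) ?\<phi> ` snd (lattice_net a p F) = snd (lattice_net b q G)"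
      using arg_cong [OF e, of snd] by (simp add: map_net_def)
    also have "?\<phi> ` closed_segment (translation a 0 p) (translation a f p) = closed_segment (translation b (\<psi> 0) q) (translation b (\<psi> f) q)"
      unfolding affine_segment \<psi> ..
    also have "\<dots> \<in> snd (lattice_net b q G) \<longleftrightarrow> \<theta> f \<in> sym_closure G"
      unfolding lattice_net_edge_iff [OF b] \<theta>_def ..
    finally show ?thesis .
  qed
  have "\<theta> ` sym_closure F = sym_closure G"
  proof (intro equalityI subsetI)
    fix y assume y: "y \<in> sym_closure G"
    obtain f where "y = \<theta> f" using \<open>surj \<theta>\<close> by (auto simp: surj_def)
    then show "y \<in> \<theta> ` sym_closure F" using edge y by blast
  qed (use edge in blast)
  then show thesis using that bij add by blast
qed

section \<open>The six classes\<close>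

definition normal_forms :: "label set set" where
  "normal_forms = {chain_labels, square_labels, triangle_labels, double_cubic_labels, triple_cubic_labels, triple_prism_labels}"

lemmas label_defs = chain_labels_def square_labels_def triangle_labels_def double_cubic_labels_def
  triple_cubic_labels_def triple_prism_labels_def

lemma admissible_normal_form: "C \<in> normal_forms \<Longrightarrow> admissible C"
  unfolding normal_forms_def
  by (elim insertE emptyE; simp add: label_defs admissible_def forall_3 vec_eq_3)

text \<open>The functionals are the third coordinate, and the coordinate sum modulo 2 and modulo 3.\<close>

lemma normal_form_disconnected:
  assumes a: "is_basis a" and C: "C \<in> normal_forms"
  shows "disconnected_net (lattice_net a p C)"
proof -
  consider "C \<in> {chain_labels, square_labels, triangle_labels}" | "C = double_cubic_labels"
    | "C \<in> {triple_cubic_labels, triple_prism_labels}"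
    using C by (auto simp: normal_forms_def)
  then show ?thesis
  proof cases
    case 1
    show ?thesis
      by (rule disconnected_lattice_net [OF a, of C 0 "vector [0,0,1]" "vector [0,0,1]"])
        (use 1 in \<open>auto simp: label_defs sum_3\<close>)
  next
    case 2
    show ?thesis
      by (rule disconnected_lattice_net [OF a, of C 2 "vector [1,1,1]" "vector [1,0,0]"])
        (use 2 in \<open>auto simp: label_defs sum_3\<close>)
  next
    case 3
    show ?thesis
      by (rule disconnected_lattice_net [OF a, of C 3 "vector [1,1,1]" "vector [1,0,0]"])
        (use 3 in \<open>auto simp: label_defs sum_3\<close>)
  qed
qed

text \<open>Three of the normal forms have the same number of labels. Among these, only the planar one contains two
  labels together with their sum. Of the other two, only the one with two interpenetrating cubic nets has
  three labels, no two of them equal or opposite, with an even sum.\<close>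

definition closed_triangle :: "label set \<Rightarrow> bool" where
  "closed_triangle D \<longleftrightarrow> (\<exists>f\<in>D. \<exists>g\<in>D. f + g \<in> D)"

definition even_sum_triple :: "label set \<Rightarrow> bool" where
  "even_sum_triple D \<longleftrightarrow> (\<exists>f\<in>D. \<exists>g\<in>D. \<exists>h\<in>D. g \<noteq> f \<and> g \<noteq> - f \<and> h \<noteq> f \<and> h \<noteq> - f \<and> h \<noteq> g \<and> h \<noteq> - g \<and>
     (\<forall>i. even (f$i + g$i + h$i)))"

lemma double_iff: "(\<exists>k :: label. x = k + k) \<longleftrightarrow> (\<forall>i. even (x$i))"
proof
  assume "\<forall>i. even (x$i)"
  then have "x = (\<chi> i. x$i div 2) + (\<chi> i. x$i div 2)" by (simp add: vec_eq_iff)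
  then show "\<exists>k. x = k + k" by blast
qed auto

lemma label_set_invariants:
  assumes \<theta>: "bij \<theta>" "\<And>x y :: label. \<theta> (x + y) = \<theta> x + \<theta> y" and D: "\<theta> ` D = E"
  shows "card E = card D" "closed_triangle E \<longleftrightarrow> closed_triangle D" "even_sum_triple E \<longleftrightarrow> even_sum_triple D"
proof -
  have inj: "inj \<theta>" using \<theta>(1) by (simp add: bij_def)
  show "card E = card D" unfolding D [symmetric] using inj by (intro card_image) (auto intro: inj_on_subset)
  have eq: "\<theta> x = \<theta> y \<longleftrightarrow> x = y" for x y using inj by (simp add: inj_eq)
  have z: "\<theta> 0 = 0" using \<theta>(2) [of 0 0] by simp
  have m: "\<theta> (- x) = - \<theta> x" for x
  proof -
    have "\<theta> (- x) + \<theta> x = 0" unfolding \<theta>(2) [symmetric] by (simp add: z)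
    then show ?thesis by (simp add: eq_neg_iff_add_eq_0)
  qed
  have mem: "\<theta> x \<in> E \<longleftrightarrow> x \<in> D" for x unfolding D [symmetric] by (rule inj_image_mem_iff [OF inj])
  show "closed_triangle E \<longleftrightarrow> closed_triangle D"
    unfolding closed_triangle_def D [symmetric] bex_simps
    by (simp add: \<theta>(2) [symmetric] inj_image_mem_iff [OF inj])
  have ex: "(\<exists>k. P k) \<longleftrightarrow> (\<exists>k. P (\<theta> k))" for P using \<theta>(1) by (metis bij_pointE)
  have even: "(\<forall>i. even (\<theta> x$i + \<theta> y$i + \<theta> z$i)) \<longleftrightarrow> (\<forall>i. even (x$i + y$i + z$i))" for x y z
  proof -
    have "(\<forall>i. even (\<theta> x$i + \<theta> y$i + \<theta> z$i)) \<longleftrightarrow> (\<exists>k. \<theta> (x + y + z) = k + k)"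
      unfolding double_iff by (simp add: \<theta>(2))
    also have "\<dots> \<longleftrightarrow> (\<exists>k. \<theta> (x + y + z) = \<theta> k + \<theta> k)" by (rule ex)
    also have "\<dots> \<longleftrightarrow> (\<exists>k. x + y + z = k + k)" by (simp only: \<theta>(2) [symmetric] eq)
    also have "\<dots> \<longleftrightarrow> (\<forall>i. even (x$i + y$i + z$i))" unfolding double_iff by simp
    finally show ?thesis .
  qed
  show "even_sum_triple E \<longleftrightarrow> even_sum_triple D"
    unfolding even_sum_triple_def D [symmetric] bex_simps
    by (simp only: m [symmetric] eq even)
qed

lemma normal_form_invariants:
  "card (sym_closure chain_labels) = 2"
  "card (sym_closure square_labels) = 4"
  "card (sym_closure triangle_labels) = 6" "closed_triangle (sym_closure triangle_labels)"
  "card (sym_closure double_cubic_labels) = 6" "\<not> closed_triangle (sym_closure double_cubic_labels)"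
    "even_sum_triple (sym_closure double_cubic_labels)"
  "card (sym_closure triple_cubic_labels) = 6" "\<not> closed_triangle (sym_closure triple_cubic_labels)"
    "\<not> even_sum_triple (sym_closure triple_cubic_labels)"
  "card (sym_closure triple_prism_labels) = 8"
  unfolding sym_closure_def label_defs closed_triangle_def even_sum_triple_def
    image_insert image_empty Un_insert_left Un_empty_left bex_simps
  by (simp_all add: card_insert_if vec_eq_3 forall_3)

lemma card_normal_forms: "card normal_forms = 6"
proof -
  have d: "C \<noteq> C'" if "card (sym_closure C) \<noteq> card (sym_closure C') \<or> closed_triangle (sym_closure C) \<noteq> closed_triangle (sym_closure C')
      \<or> even_sum_triple (sym_closure C) \<noteq> even_sum_triple (sym_closure C')" for C C'
    using that by auto
  have "distinct [chain_labels, square_labels, triangle_labels, double_cubic_labels, triple_cubic_labels, triple_prism_labels]"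
    unfolding distinct.simps list.set insert_iff empty_iff de_Morgan_disj
    by (intro conjI d TrueI notI) (auto simp: normal_form_invariants)
  then have "card (set [chain_labels, square_labels, triangle_labels, double_cubic_labels, triple_cubic_labels, triple_prism_labels]) = 6"
    by (subst distinct_card) simp_all
  then show ?thesis by (simp add: normal_forms_def)
qed

lemma is_basis_axis: "is_basis (\<lambda>i. axis i 1)"
  by (rule is_basis_if_spanning) (simp add: span_base)

lemma normal_forms_inequivalent:
  assumes C: "C \<in> normal_forms" and C': "C' \<in> normal_forms" and a: "is_basis a" "is_basis b"
    and eq: "(lattice_net a p C, lattice_net b q C') \<in> affine_equivalence"
  shows "C = C'"
proof -
  obtain \<theta> where \<theta>: "bij \<theta>" "\<And>x y. \<theta> (x + y) = \<theta> x + \<theta> y" "\<theta> ` sym_closure C = sym_closure C'"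
    using affine_equivalence_labels [OF eq a] by metis
  note inv = label_set_invariants [OF \<theta>]
  show ?thesis
    using C C' inv unfolding normal_forms_def
    by (elim insertE emptyE) (simp_all add: normal_form_invariants)
qed

theorem theorem9p1:
  "card ({\<N>. proper_linear_3_periodic_net \<N> \<and> disconnected_net \<N> \<and>
             adjacency_depth \<N> = 1 \<and> single_vertex_quotient_graph \<N>} // affine_equivalence) = 6"
proof -
  let ?A = "{\<N>. proper_linear_3_periodic_net \<N> \<and> disconnected_net \<N> \<and>
             adjacency_depth \<N> = 1 \<and> single_vertex_quotient_graph \<N>}"
  let ?R = "\<lambda>C. lattice_net (\<lambda>i. axis i 1) 0 C"
  let ?class = "\<lambda>C. affine_equivalence `` {?R C}"
  have R: "?R C \<in> ?A" if "C \<in> normal_forms" for C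
    using admissible_normal_form [OF that] normal_form_disconnected [OF is_basis_axis that]
      proper_lattice_net [OF is_basis_axis] adjacency_depth_lattice_net [OF is_basis_axis]
      single_vertex_lattice_net [OF is_basis_axis admissible_finite] by blast
  have cover: "\<exists>C\<in>normal_forms. (\<N>, ?R C) \<in> affine_equivalence" if N: "\<N> \<in> ?A" for \<N>
  proof -
    obtain a p F where a: "is_basis a" and eq: "\<N> = lattice_net a p F" and F: "admissible F" "\<And>f. f \<in> F \<Longrightarrow> - f \<in> F"
      using depth_1_labels [of \<N>] N by blast
    have "\<bar>det3 f g h\<bar> \<noteq> 1" if "f \<in> F" "g \<in> F" "h \<in> F" for f g h
      using unimodular_labels_connected [OF a that] N eq by auto
    then obtain C where C: "C \<in> normal_forms" "unimodular_image C F"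
      using label_set_classification [OF F] unfolding normal_forms_def by blast
    then obtain B :: "int^3^3" where B: "\<bar>det B\<bar> = 1" and FB: "F = sym_closure ((\<lambda>c. c v* B) ` C)"
      unfolding unimodular_image_def by blast
    define b where "b = (\<lambda>i. frame a (real_vec (B$i)))"
    have b: "is_basis b" "\<N> = lattice_net b p C"
      unfolding b_def eq FB lattice_net_sym_closure using lattice_net_basis_change [OF a B] by simp_all
    have "(lattice_net b p C, ?R C) \<in> affine_equivalence"
      by (rule lattice_nets_affinely_equivalent [OF b(1) is_basis_axis]) (use N R [OF C(1)] b(2) in auto)
    then show ?thesis using C(1) b(2) by blast
  qed
  have refl: "(\<N>, \<N>) \<in> affine_equivalence" if "proper_linear_3_periodic_net \<N>" for \<N>
  proof -
    have "\<N> = map_net (\<lambda>x. 0 + mat 1 *v x) \<N>" by (simp add: map_net_def)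
    moreover have "invertible (mat 1 :: real^3^3)" by (simp add: invertible_def)
    ultimately show ?thesis unfolding affine_equivalence_iff using that by blast
  qed
  have class_eq: "affine_equivalence `` {\<M>} = affine_equivalence `` {\<N>}" if "(\<M>, \<N>) \<in> affine_equivalence" for \<M> \<N>
    using that affine_equivalence_sym affine_equivalence_trans by (blast dest: symD transD)
  have "?A // affine_equivalence = ?class ` normal_forms"
  proof (intro equalityI subsetI)
    fix K assume "K \<in> ?A // affine_equivalence"
    then obtain \<N> where N: "\<N> \<in> ?A" and K: "K = affine_equivalence `` {\<N>}" by (rule quotientE)
    obtain C where "C \<in> normal_forms" "(\<N>, ?R C) \<in> affine_equivalence" using cover [OF N] by blast
    then show "K \<in> ?class ` normal_forms" unfolding K using class_eq by blast
  next
    fix K assume "K \<in> ?class ` normal_forms"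
    then obtain C where "C \<in> normal_forms" and K: "K = ?class C" by blast
    then show "K \<in> ?A // affine_equivalence" unfolding K by (intro quotientI R)
  qed
  moreover have "inj_on ?class normal_forms"
  proof (rule inj_onI)
    fix C C' assume C: "C \<in> normal_forms" "C' \<in> normal_forms" and eq: "?class C = ?class C'"
    have "?R C' \<in> ?class C'" using refl R [OF C(2)] by blast
    then have "(?R C, ?R C') \<in> affine_equivalence" using eq by blast
    then show "C = C'" by (rule normal_forms_inequivalent [OF C is_basis_axis is_basis_axis])
  qed
  ultimately show ?thesis by (simp add: card_image card_normal_forms)
qed

end
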